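(* Let $f\in C(G^{2})$. For every $A>0$ there exists a positive constant $c(f,A)$, depending only on $f$ and $A$, such that for every integer $n\ge 1$ $$\left\Vert \frac{1}{n}\sum_{l=1}^{n}\left( e^{A\left\vert S_{l,l}^{\kappa}(f)-f\right\vert ^{1/2}}-1\right) \right\Vert _{C}\leq \frac{c(f,A)}{n}\sum_{l=1}^{n}\left( \sqrt{E_{l}^{(1)}(f)}+\sqrt{E_{l}^{(2)}(f)}\right).$$
   Context: $\mathbb{N}=\{0,1,2,\dots\}$. $G=\prod_{k\in\mathbb{N}}\mathbb{Z}_2$ is the Walsh group (compact abelian group with product topology, elements $x=(x_0,x_1,\dots)$, $x_k\in\{0,1\}$, coordinatewise addition mod 2), with product measure $\mu$ in which each factor gives mass $1/2$ to each point; $G^2=G\times G$ carries the product measure (also denoted $\mu$). $C(G^2)$ is the space of continuous real-valued functions on $G^2$ and $\|g\|_C=\sup_{(x,y)\in G^2}|g(x,y)|$. Rademacher functions: $r_k(x)=(-1)^{x_k}$. For $n\ge1$ with binary expansion $n=\sum_i n_i2^i$, $n_i\in\{0,1\}$, let $|n|=\max\{j:n_j\ne0\}$. Walsh-Kaczmarz functions: $\kappa_0=1$ and, for $n\ge1$, $\kappa_n(x)=r_{|n|}(x)\prod_{k=0}^{|n|-1}(r_{|n|-1-k}(x))^{n_k}$. For $f\in C(G^2)$: $\hat f^{\kappa}(k,i)=\int_{G^2}f(x,y)\kappa_k(x)\kappa_i(y)\,d\mu(x,y)$ and $S_{n,m}^{\kappa}(f;x,y)=\sum_{k=0}^{n-1}\sum_{i=0}^{m-1}\hat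 f^{\kappa}(k,i)\kappa_k(x)\kappa_i(y)$; $S_{n,m}^\kappa(f)$ denotes the function $(x,y)\mapsto S_{n,m}^\kappa(f;x,y)$. Partial best approximations: for $l\ge1$, $E_l^{(1)}(f)=\inf\|f-T\|_C$, the infimum over all $T(x,y)=\sum_{j=0}^{l-1}\alpha_j(y)\kappa_j(x)$ with $\alpha_j$ continuous on $G$; $E_l^{(2)}(f)$ is defined analogously with the roles of $x$ and $y$ exchanged, i.e. over $T(x,y)=\sum_{j=0}^{l-1}\beta_j(x)\kappa_j(y)$ with $\beta_j$ continuous on $G$. *)

theory Defs
  imports "HOL-Probability.Probability"
begin

text \<open>
  Points of the Walsh group are sequences of booleans, \<^const>\<open>True\<close> standing for the residue
  \<open>1\<close> and \<^const>\<open>False\<close> for \<open>0\<close>; \<^typ>\<open>bool\<close> carries the discrete topology, so the function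
  type carries the product topology. The group operation (coordinatewise exclusive or) is not
  needed below.
\<close>

type_synonym walsh = "nat \<Rightarrow> bool"

definition walsh_measure :: "walsh measure"
  where "walsh_measure = (\<Pi>\<^sub>M k\<in>UNIV. uniform_count_measure (UNIV :: bool set))"

definition walsh_measure2 :: "(walsh \<times> walsh) measure"
  where "walsh_measure2 = walsh_measure \<Otimes>\<^sub>M walsh_measure"

text \<open>The supremum is a conditional one on \<^typ>\<open>real\<close>, hence meaningful for bounded \<open>g\<close> only;
  continuous functions are bounded since the domain is compact.\<close>

definition sup_norm :: "(walsh \<times> walsh \<Rightarrow> real) \<Rightarrow> real"
  where "sup_norm g = (SUP z. \<bar>g z\<bar>)"

definition rademacher :: "nat \<Rightarrow> walsh \<Rightarrow> real"
  where "rademacher k x = (-1) ^ of_bool (x k)"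

definition top_bit :: "nat \<Rightarrow> nat"
  where "top_bit n = Max {j. bit n j}"

definition kaczmarz :: "nat \<Rightarrow> walsh \<Rightarrow> real"
  where "kaczmarz n x =
    (if n = 0 then 1
     else rademacher (top_bit n) x *
       (\<Prod>k<top_bit n. rademacher (top_bit n - 1 - k) x ^ of_bool (bit n k)))"

definition kaczmarz_coeff :: "(walsh \<times> walsh \<Rightarrow> real) \<Rightarrow> nat \<Rightarrow> nat \<Rightarrow> real"
  where "kaczmarz_coeff f k i =
    (\<integral>(x, y). f (x, y) * kaczmarz k x * kaczmarz i y \<partial>walsh_measure2)"

definition kaczmarz_sum ::
    "nat \<Rightarrow> nat \<Rightarrow> (walsh \<times> walsh \<Rightarrow> real) \<Rightarrow> walsh \<times> walsh \<Rightarrow> real"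
  where "kaczmarz_sum n m f =
    (\<lambda>(x, y). \<Sum>k<n. \<Sum>i<m. kaczmarz_coeff f k i * kaczmarz k x * kaczmarz i y)"

definition best_approx1 :: "nat \<Rightarrow> (walsh \<times> walsh \<Rightarrow> real) \<Rightarrow> real"
  where "best_approx1 l f =
    (INF \<alpha> \<in> {\<alpha> :: nat \<Rightarrow> walsh \<Rightarrow> real. \<forall>j<l. continuous_on UNIV (\<alpha> j)}.
      sup_norm (\<lambda>(x, y). f (x, y) - (\<Sum>j<l. \<alpha> j y * kaczmarz j x)))"

definition best_approx2 :: "nat \<Rightarrow> (walsh \<times> walsh \<Rightarrow> real) \<Rightarrow> real"
  where "best_approx2 l f =
    (INF \<beta> \<in> {\<beta> :: nat \<Rightarrow> walsh \<Rightarrow> real. \<forall>j<l. continuous_on UNIV (\<beta> j)}.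
      sup_norm (\<lambda>(x, y). f (x, y) - (\<Sum>j<l. \<beta> j x * kaczmarz j y)))"

end

theory Submission
  imports Defs
begin

text \<open>
  Let \<open>2\<^sup>N \<le> n < 2\<^bsup>N+1\<^esup>\<close>. Cutting \<open>{0..<n}\<close> at the binary digits of \<open>n\<close> decomposes the Dirichlet kernel
  into at most \<open>N + 1\<close> pieces, each a character times a nonnegative kernel with integral \<open>1\<close>. So
  \<open>S\<^bsub>n,n\<^esub> g\<close> is a sum of terms \<open>X\<^bsub>ij\<^esub>\<close> indexed by pairs of digit positions \<open>i, j \<le> N\<close> which, for
  \<open>\<bar>g\<bar> \<le> 1\<close>, are bounded by \<open>1\<close>. As \<open>n\<close> varies, \<open>X\<^bsub>ij\<^esub>\<close> runs through Fourier coefficients of one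
  bounded function, each repeated at most \<open>2\<^bsup>min i j + 1\<^esup>\<close> times, so Bessel's inequality makes its mean
  square over the block at most \<open>2 \<cdot> 2\<^bsup>min i j - N\<^esup>\<close>. This geometric decay bounds the block mean of
  \<open>exp (\<bar>S\<^bsub>n,n\<^esub> g\<bar>\<^bsup>1/2\<^esup> / 4)\<close> uniformly in \<open>N\<close>.

  The theorem follows by applying this to \<open>g = f - S\<^bsub>M,M\<^esub> f\<close> with \<open>M = 2\<^sup>N\<close>, a function of norm at most
  \<open>2 E\<^sub>M\<^sup>1 + 2 E\<^sub>M\<^sup>2\<close> because \<open>S\<^bsub>M,M\<^esub>\<close> averages over dyadic cells, on which the approximating
  polynomials are constant. The norm of \<open>g\<close> tends to \<open>0\<close>, so convexity of \<open>exp\<close> reduces the factor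
  \<open>A\<close> to \<open>1/4\<close> except for finitely many \<open>N\<close>; this is where the constant depends on \<open>f\<close>.
\<close>

section \<open>The Walsh group as a compact probability space\<close>

text \<open>Second countability makes the product sigma-algebra on \<open>walsh\<close> coincide
  with the Borel sets of the product topology, through \<open>sets_PiM_equal_borel\<close>.\<close>

instance bool :: second_countable_topology
proof
  show "\<exists>B :: bool set set. countable B \<and> open = generate_topology B"
    by (intro exI[of _ "range (\<lambda>a. {..<a}) \<union> range (\<lambda>a. {a<..})"] conjI open_bool_def) auto
qed

lemma compact_UNIV_walsh: "compact (UNIV :: walsh set)"
proof -
  have "compact_space (product_topology (\<lambda>i::nat. euclidean :: bool topology) UNIV)"
    unfolding compact_space_product_topology
    by (auto simp: compact_space_def intro: finite_imp_compact)
  then show ?thesis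
    by (simp add: euclidean_product_topology compact_space_def)
qed

lemma compact_UNIV_walsh2: "compact (UNIV :: (walsh \<times> walsh) set)"
  using compact_Times[OF compact_UNIV_walsh compact_UNIV_walsh] by simp

lemma continuous_bounded:
  fixes g :: "walsh \<times> walsh \<Rightarrow> real"
  assumes "continuous_on UNIV g"
  obtains B where "\<And>z. \<bar>g z\<bar> \<le> B"
proof -
  have "bounded (range g)"
    using assms compact_UNIV_walsh2 compact_continuous_image compact_imp_bounded by blast
  then show ?thesis using that by (auto simp: bounded_iff)
qed

lemma le_sup_norm:
  assumes "continuous_on UNIV g"
  shows "\<bar>g z\<bar> \<le> sup_norm g"
proof -
  obtain B where "\<And>z. \<bar>g z\<bar> \<le> B" using continuous_bounded[OF assms] by blast
  then show ?thesis unfolding sup_norm_def by (intro cSUP_upper bdd_aboveI2) auto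
qed

lemma sup_norm_le: "(\<And>z. \<bar>g z\<bar> \<le> B) \<Longrightarrow> sup_norm g \<le> B"
  unfolding sup_norm_def by (intro cSUP_least) auto

lemma continuous_on_rademacher [continuous_intros]:
  assumes "continuous_on S g"
  shows "continuous_on S (\<lambda>z. rademacher k (g z))"
proof -
  have "continuous_on UNIV (\<lambda>b::bool. (-1::real) ^ of_bool b)"
    by (auto simp: continuous_on_open_vimage intro: open_discrete)
  moreover have "continuous_on S (\<lambda>z. g z k)"
    using assms by (rule continuous_on_product_then_coordinatewise)
  ultimately show ?thesis unfolding rademacher_def
    by (rule continuous_on_compose2) auto
qed

lemma continuous_on_kaczmarz [continuous_intros]:
  assumes "continuous_on S g"
  shows "continuous_on S (\<lambda>z. kaczmarz n (g z))"
  unfolding kaczmarz_def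
  by (cases "n = 0") (auto intro!: continuous_intros assms)

lemma sets_walsh [measurable_cong]: "sets walsh_measure = sets borel"
proof -
  have "sets (uniform_count_measure (UNIV :: bool set)) = sets (borel :: bool measure)"
    by (simp add: sets_borel_eq_count_space sets_uniform_count_measure)
  then have "sets walsh_measure = sets (\<Pi>\<^sub>M k\<in>(UNIV::nat set). (borel :: bool measure))"
    unfolding walsh_measure_def by (intro sets_PiM_cong) auto
  then show ?thesis by (simp add: sets_PiM_equal_borel)
qed

lemma sets_walsh2 [measurable_cong]: "sets walsh_measure2 = sets borel"
  unfolding walsh_measure2_def borel_prod[symmetric]
  by (intro sets_pair_measure_cong sets_walsh)

interpretation walsh_coords: product_prob_space "\<lambda>_. uniform_count_measure (UNIV :: bool set)" "UNIV :: nat set"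
  by (intro product_prob_spaceI prob_space_uniform_count_measure) auto

interpretation walsh: prob_space walsh_measure
  unfolding walsh_measure_def by unfold_locales

interpretation walsh2: pair_prob_space walsh_measure walsh_measure ..

interpretation walsh2_prob: prob_space walsh_measure2
  unfolding walsh_measure2_def by (rule walsh2.P.prob_space_axioms)

lemma integrable_walsh:
  fixes g :: "walsh \<Rightarrow> real"
  assumes "continuous_on UNIV g"
  shows "integrable walsh_measure g"
proof -
  have "bounded (range g)"
    using assms compact_UNIV_walsh compact_continuous_image compact_imp_bounded by blast
  then obtain B where "\<And>z. norm (g z) \<le> B" by (auto simp: bounded_iff)
  moreover have "g \<in> borel_measurable walsh_measure"
    using borel_measurable_continuous_onI[OF assms] by measurable
  ultimately show ?thesis by (intro walsh.integrable_const_bound) auto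
qed

lemma integrable_walsh2:
  fixes g :: "walsh \<times> walsh \<Rightarrow> real"
  assumes "continuous_on UNIV g"
  shows "integrable walsh_measure2 g"
proof -
  obtain B where "\<And>z. \<bar>g z\<bar> \<le> B" using continuous_bounded[OF assms] by blast
  moreover have "g \<in> borel_measurable walsh_measure2"
    using borel_measurable_continuous_onI[OF assms] by measurable
  ultimately show ?thesis by (intro walsh2_prob.integrable_const_bound[where B=B]) auto
qed

lemma integral_walsh2_times:
  fixes a b :: "walsh \<Rightarrow> real"
  assumes "continuous_on UNIV a" "continuous_on UNIV b"
  shows "(\<integral>z. a (fst z) * b (snd z) \<partial>walsh_measure2) = (\<integral>x. a x \<partial>walsh_measure) * (\<integral>y. b y \<partial>walsh_measure)"
proof -
  have "integrable walsh_measure2 (\<lambda>z. a (fst z) * b (snd z))"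
    by (intro integrable_walsh2 continuous_intros continuous_on_compose2[OF assms(1)]
        continuous_on_compose2[OF assms(2)]) auto
  then have "(\<integral>x. \<integral>y. a x * b y \<partial>walsh_measure \<partial>walsh_measure) = (\<integral>z. a (fst z) * b (snd z) \<partial>walsh_measure2)"
    unfolding walsh_measure2_def by (subst walsh2.integral_fst'[symmetric]) auto
  then show ?thesis by simp
qed

text \<open>The marginal on finitely many coordinates is a finite product measure, so the integral
  factorises and each fair coin averages two values.\<close>

lemma integral_walsh_prod:
  fixes g :: "nat \<Rightarrow> bool \<Rightarrow> real"
  assumes "finite I"
  shows "(\<integral>x. (\<Prod>i\<in>I. g i (x i)) \<partial>walsh_measure) = (\<Prod>i\<in>I. (g i True + g i False) / 2)"
proof -
  let ?B = "uniform_count_measure (UNIV :: bool set)"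
  have meas: "h \<in> borel_measurable ?B" for h :: "bool \<Rightarrow> real"
    by (simp add: measurable_def sets_uniform_count_measure space_uniform_count_measure)
  have int: "integrable ?B h" for h :: "bool \<Rightarrow> real"
  proof (rule walsh_coords.M.integrable_const_bound[where B = "max \<bar>h True\<bar> \<bar>h False\<bar>", OF _ meas])
    show "AE b in ?B. norm (h b) \<le> max \<bar>h True\<bar> \<bar>h False\<bar>"
      by (rule AE_I2) (metis max.cobounded1 max.cobounded2 real_norm_def)
  qed
  have val: "(\<integral>b. h b \<partial>?B) = (h True + h False) / 2" for h :: "bool \<Rightarrow> real"
    unfolding uniform_count_measure_def
    by (subst lebesgue_integral_point_measure_finite) (simp_all add: UNIV_bool)
  have "(\<integral>x. (\<Prod>i\<in>I. g i (x i)) \<partial>PiM I (\<lambda>_. ?B))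
      = (\<integral>x. (\<Prod>i\<in>I. g i (x i)) \<partial>distr walsh_measure (PiM I (\<lambda>_. ?B)) (\<lambda>x. restrict x I))"
    using walsh_coords.distr_PiM_restrict_finite[OF assms] by (simp add: walsh_measure_def)
  also have "\<dots> = (\<integral>x. (\<Prod>i\<in>I. g i (x i)) \<partial>walsh_measure)"
    by (subst integral_distr)
       (auto simp: walsh_measure_def intro!: borel_measurable_prod measurable_restrict_subset
          measurable_compose[OF measurable_component_singleton] meas)
  finally show ?thesis
    using walsh_coords.product_integral_prod[OF assms, of g] by (simp add: int val)
qed

section \<open>Orthonormality and dyadic blocks of the Dirichlet kernel\<close>

lemma rademacher_mult_self [simp]: "rademacher k x * rademacher k x = 1"
  by (simp add: rademacher_def flip: power_add)

lemma abs_rademacher [simp]: "\<bar>rademacher k x\<bar> = 1"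
  by (simp add: rademacher_def power_abs)

lemma abs_kaczmarz [simp]: "\<bar>kaczmarz n x\<bar> = 1"
  by (simp add: kaczmarz_def abs_mult abs_prod power_abs)

lemma kaczmarz_mult_self [simp]: "kaczmarz n x * kaczmarz n x = 1"
  by (metis abs_kaczmarz abs_mult_self_eq mult_1)

lemma kaczmarz_0 [simp]: "kaczmarz 0 x = 1"
  by (simp add: kaczmarz_def)

section \<open>Binary digits and the Rademacher factors of a Kaczmarz function\<close>

lemma bit_dyadic_top:
  fixes n :: nat
  assumes "2 ^ N \<le> n" "n < 2 ^ Suc N"
  shows "bit n N" and "bit n k \<Longrightarrow> k \<le> N"
proof -
  have "n div 2 ^ N = 1" using assms by (intro div_nat_eqI) auto
  then show "bit n N" by (simp add: bit_iff_odd)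
  show "k \<le> N" if "bit n k"
  proof (rule ccontr)
    assume "\<not> k \<le> N"
    then have "(2::nat) ^ Suc N \<le> 2 ^ k" by (intro power_increasing) auto
    with assms(2) that show False by (simp add: bit_iff_odd)
  qed
qed

lemma top_bit_eq:
  assumes "2 ^ N \<le> n" "n < 2 ^ Suc N"
  shows "top_bit n = N"
  unfolding top_bit_def
proof (rule Max_eqI)
  show "finite {j. bit n j}"
    by (rule finite_subset[of _ "{..N}"]) (use bit_dyadic_top(2)[OF assms] in auto)
qed (use bit_dyadic_top[OF assms] in auto)

lemma ex_dyadic_top:
  assumes "n \<ge> (1::nat)"
  obtains N where "2 ^ N \<le> n" "n < 2 ^ Suc N"
  using ex_power_ivl1[of 2 n] assms by auto

lemma top_bit_bounds:
  assumes "n \<noteq> 0"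
  shows "2 ^ top_bit n \<le> n" "n < 2 ^ Suc (top_bit n)"
proof -
  obtain N where "2 ^ N \<le> n" "n < 2 ^ Suc N" using ex_dyadic_top[of n] assms by auto
  with top_bit_eq show "2 ^ top_bit n \<le> n" "n < 2 ^ Suc (top_bit n)" by auto
qed

text \<open>The coordinates whose Rademacher function occurs in \<open>kaczmarz n\<close>: the top
  digit stays in place, the digits below it are read backwards.\<close>

definition kaczmarz_supp :: "nat \<Rightarrow> nat set"
  where "kaczmarz_supp n =
    {l. n \<noteq> 0 \<and> (l = top_bit n \<or> l < top_bit n \<and> bit n (top_bit n - 1 - l))}"

text \<open>The range \<open>L\<close> is only bounded below by \<open>n\<close>, so two Kaczmarz
  functions can be written over a common range and multiplied coordinate by coordinate.\<close>

lemma kaczmarz_eq_prod: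
  assumes "n < 2 ^ L"
  shows "kaczmarz n x = (\<Prod>l<L. rademacher l x ^ of_bool (l \<in> kaczmarz_supp n))"
proof (cases "n = 0")
  case True
  then show ?thesis by (simp add: kaczmarz_supp_def)
next
  case False
  define N where "N = top_bit n"
  have "N < L"
    using top_bit_bounds(1)[OF False] assms order_le_less_trans power_less_imp_less_exp[of 2]
    unfolding N_def by (metis one_less_numeral_iff semiring_norm(76))
  have "(\<Prod>l<L. rademacher l x ^ of_bool (l \<in> kaczmarz_supp n)) =
      (\<Prod>l<Suc N. rademacher l x ^ of_bool (l \<in> kaczmarz_supp n))"
    using \<open>N < L\<close> by (intro prod.mono_neutral_right) (auto simp: kaczmarz_supp_def N_def)
  also have "\<dots> = rademacher N x * (\<Prod>l<N. rademacher l x ^ of_bool (bit n (N - 1 - l)))"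
    using False by (simp add: kaczmarz_supp_def N_def)
  also have "(\<Prod>l<N. rademacher l x ^ of_bool (bit n (N - 1 - l))) =
      (\<Prod>k<N. rademacher (N - Suc k) x ^ of_bool (bit n (N - 1 - (N - Suc k))))"
    by (rule prod.nat_diff_reindex[symmetric])
  also have "\<dots> = (\<Prod>k<N. rademacher (N - 1 - k) x ^ of_bool (bit n k))"
    by (intro prod.cong) auto
  finally show ?thesis using False by (simp add: kaczmarz_def N_def)
qed

text \<open>The maximum of the support recovers the top digit \<open>N\<close>; after that,
  membership of \<open>N - 1 - k\<close> recovers digit \<open>k\<close>.\<close>

lemma kaczmarz_supp_inject: 
  assumes "kaczmarz_supp m = kaczmarz_supp n"
  shows "m = n"
proof (cases "m = 0 \<or> n = 0")
  case True
  then show ?thesis using assms by (auto simp: kaczmarz_supp_def)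
next
  case False
  have Max: "Max (kaczmarz_supp k) = top_bit k" if "k \<noteq> 0" for k
    using that by (intro Max_eqI) (auto simp: kaczmarz_supp_def)
  define N where "N = top_bit n"
  have N: "top_bit m = N" using Max[of m] Max[of n] assms False by (simp add: N_def)
  show ?thesis
  proof (rule bit_eqI)
    fix k
    consider "k < N" | "k = N" | "k > N" by linarith
    then show "bit m k = bit n k"
    proof cases
      case 1
      then have "bit j k \<longleftrightarrow> N - 1 - k \<in> kaczmarz_supp j" if "top_bit j = N" "j \<noteq> 0" for j
        using that by (auto simp: kaczmarz_supp_def)
      from this[of m] this[of n] show ?thesis using N False assms N_def by metis
    next
      case 2
      then show ?thesis
        using bit_dyadic_top(1)[OF top_bit_bounds, of m] bit_dyadic_top(1)[OF top_bit_bounds, of n]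
          False N N_def by simp
    next
      case 3
      then show ?thesis using bit_dyadic_top(2)[OF top_bit_bounds] False N N_def
        by (metis not_le)
    qed
  qed
qed

text \<open>A coordinate in exactly one of the two supports carries a single sign, whose average is
  0; every other coordinate averages to 1. Distinct indices have distinct supports, so such a
  coordinate exists exactly when \<open>m\<close> and \<open>n\<close> differ.\<close>

lemma kaczmarz_orthonormal:
  "(\<integral>x. kaczmarz m x * kaczmarz n x \<partial>walsh_measure) = of_bool (m = n)"
proof -
  define L where "L = max m n"
  have L: "m < 2 ^ L" "n < 2 ^ L"
    using less_exp[of m] less_exp[of n] power_increasing[of m L "2::nat"]
      power_increasing[of n L "2::nat"] unfolding L_def by linarith+
  define g where "g l b = ((-1) ^ of_bool b :: real) ^ of_bool (l \<in> kaczmarz_supp m) *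
    ((-1) ^ of_bool b) ^ of_bool (l \<in> kaczmarz_supp n)" for l :: nat and b
  have "(\<integral>x. kaczmarz m x * kaczmarz n x \<partial>walsh_measure) = (\<integral>x. (\<Prod>l<L. g l (x l)) \<partial>walsh_measure)"
    by (simp add: kaczmarz_eq_prod[OF L(1)] kaczmarz_eq_prod[OF L(2)] prod.distrib g_def rademacher_def)
  also have "\<dots> = (\<Prod>l<L. of_bool (l \<in> kaczmarz_supp m \<longleftrightarrow> l \<in> kaczmarz_supp n))"
    by (subst integral_walsh_prod) (auto simp: g_def intro!: prod.cong)
  also have "\<dots> = of_bool (\<forall>l<L. l \<in> kaczmarz_supp m \<longleftrightarrow> l \<in> kaczmarz_supp n)"
    by (induction L) (auto simp: less_Suc_eq)
  also have "(\<forall>l<L. l \<in> kaczmarz_supp m \<longleftrightarrow> l \<in> kaczmarz_supp n) \<longleftrightarrow> m = n"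
  proof
    have sub: "kaczmarz_supp k \<subseteq> {..<L}" if "k < 2 ^ L" for k
    proof
      fix l assume l: "l \<in> kaczmarz_supp k"
      then have "(2::nat) ^ l \<le> 2 ^ top_bit k"
        by (intro power_increasing) (auto simp: kaczmarz_supp_def)
      also have "\<dots> \<le> k" using l by (intro top_bit_bounds) (auto simp: kaczmarz_supp_def)
      finally have "(2::nat) ^ l < 2 ^ L" using that by linarith
      then show "l \<in> {..<L}" by (simp add: power_less_imp_less_exp)
    qed
    assume "\<forall>l<L. l \<in> kaczmarz_supp m \<longleftrightarrow> l \<in> kaczmarz_supp n"
    then show "m = n" using sub[OF L(1)] sub[OF L(2)] by (intro kaczmarz_supp_inject) blast
  qed auto
  finally show ?thesis .
qed

text \<open>The Kaczmarz order reverses the digits, so the \<open>2\<^sup>j\<close> functions of a dyadic block inside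
  \<open>[2\<^sup>N, 2\<^sup>N\<^sup>+\<^sup>1)\<close> differ only in the coordinates \<open>N - j, \<dots>, N - 1\<close>.\<close>

definition block_kernel :: "nat \<Rightarrow> nat \<Rightarrow> walsh \<Rightarrow> walsh \<Rightarrow> real"
  where "block_kernel N j x s = (\<Prod>l\<in>{N - j..<N}. 1 + rademacher l x * rademacher l s)"

lemma block_kernel_nonneg: "block_kernel N j x s \<ge> 0"
proof -
  have "1 + rademacher l x * rademacher l s \<ge> 0" for l
    using abs_le_D2[of "rademacher l x * rademacher l s" 1] by (simp add: abs_mult)
  then show ?thesis unfolding block_kernel_def by (intro prod_nonneg) auto
qed

lemma continuous_on_block_kernel [continuous_intros]:
  assumes "continuous_on S g"
  shows "continuous_on S (\<lambda>z. block_kernel N j x (g z))"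
  unfolding block_kernel_def by (intro continuous_intros assms)

lemma integral_block_kernel: "(\<integral>s. block_kernel N j x s \<partial>walsh_measure) = 1"
  using integral_walsh_prod[of "{N - j..<N}" "\<lambda>l b. 1 + rademacher l x * (-1) ^ of_bool b"]
  by (simp add: block_kernel_def rademacher_def)

text \<open>Digit \<open>j\<close> is clear, so the addition sets it without a carry and the top
  digit stays. The reversed order turns the new digit into the Rademacher factor of index
  \<open>N - 1 - j\<close>.\<close>

lemma kaczmarz_add_power:
  assumes n: "2 ^ N \<le> n" "n < 2 ^ Suc N" and "j < N" "\<not> bit n j"
  shows "kaczmarz (n + 2 ^ j) x = rademacher (N - 1 - j) x * kaczmarz n x"
proof -
  have m: "n + 2 ^ j = set_bit j n" using assms by (simp add: set_bit_eq)
  have bit: "bit (n + 2 ^ j) k \<longleftrightarrow> k = j \<or> bit n k" for k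
    unfolding m by (auto simp: bit_set_bit_iff)
  \<comment> \<open>Otherwise digit \<open>Suc N\<close> of the sum would be set, although only
    digit \<open>j\<close> was added.\<close>
  have "n + 2 ^ j < 2 ^ Suc N"
  proof (rule ccontr)
    assume "\<not> ?thesis"
    then have "2 ^ Suc N \<le> n + 2 ^ j" by simp
    moreover have "(2::nat) ^ Suc j \<le> 2 ^ N" using \<open>j < N\<close> by (intro power_increasing) auto
    ultimately have "bit (n + 2 ^ j) (Suc N)"
      using n(2) by (intro bit_dyadic_top(1)) auto
    then show False using bit bit_dyadic_top(2)[OF n, of "Suc N"] \<open>j < N\<close> by auto
  qed
  then have top: "top_bit (n + 2 ^ j) = N" using n by (intro top_bit_eq) auto
  have "(\<Prod>k<N. rademacher (N - 1 - k) x ^ of_bool (bit (n + 2 ^ j) k)) =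
      rademacher (N - 1 - j) x * (\<Prod>k<N. rademacher (N - 1 - k) x ^ of_bool (bit n k))"
    using assms by (simp add: prod.remove[of "{..<N}" j] bit)
  moreover have "n \<noteq> 0" using n(1) by (metis not_less0 pos2 zero_less_power not_le gr0I)
  ultimately show ?thesis
    by (simp add: kaczmarz_def top top_bit_eq[OF n])
qed

section \<open>Decomposition of the Dirichlet kernel into dyadic blocks\<close>

lemma sum_lessThan_add:
  fixes h :: "nat \<Rightarrow> 'a::comm_monoid_add"
  shows "(\<Sum>i<a + b. h i) = (\<Sum>i<a. h i) + (\<Sum>i<b. h (a + i))"
  by (induction b) (simp_all add: add_ac)

text \<open>The induction doubles the block. Divisibility by \<open>2 ^ Suc j\<close> leaves digit
  \<open>j\<close> clear throughout the first half, so the second half repeats the first with one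
  more Rademacher factor in each variable, and the kernel gains one factor of the product.\<close>

lemma sum_dyadic_block:
  assumes p: "2 ^ N \<le> p" "p < 2 ^ Suc N" and "j \<le> N" "2 ^ j dvd p"
  shows "(\<Sum>q<2 ^ j. kaczmarz (p + q) x * kaczmarz (p + q) s) =
    kaczmarz p x * kaczmarz p s * block_kernel N j x s"
  using \<open>j \<le> N\<close> \<open>2 ^ j dvd p\<close>
proof (induction j)
  case 0
  then show ?case by (simp add: block_kernel_def)
next
  case (Suc j)
  let ?r = "rademacher (N - 1 - j) x * rademacher (N - 1 - j) s"
  have dvd: "2 ^ j dvd p" using Suc.prems(2) by (rule power_le_dvd) auto
  have step: "kaczmarz (p + (2 ^ j + q)) y = rademacher (N - 1 - j) y * kaczmarz (p + q) y"
    if "q < 2 ^ j" for q y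
  proof -
    obtain a where a: "p = 2 ^ Suc j * a" using Suc.prems(2) by blast
    have "(p + q) div 2 ^ j = 2 * a" using that by (intro div_nat_eqI) (auto simp: a)
    then have "\<not> bit (p + q) j" by (simp add: bit_iff_odd)
    moreover have "p + q < 2 ^ Suc N"
    proof -
      have "2 ^ j * (2 * a) < 2 ^ j * 2 ^ (Suc N - j)"
        using p(2) Suc.prems(1) by (simp add: a flip: power_add)
      then have "2 * a + 1 \<le> 2 ^ (Suc N - j)" by simp
      then have "2 ^ j * (2 * a + 1) \<le> 2 ^ j * 2 ^ (Suc N - j)" by (intro mult_le_mono2)
      also have "\<dots> = 2 ^ Suc N" using Suc.prems(1) by (simp flip: power_add)
      finally show ?thesis using that by (simp add: a algebra_simps)
    qed
    ultimately show ?thesis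
      using p(1) Suc.prems(1) kaczmarz_add_power[of N "p + q" j y] by (simp add: add_ac)
  qed
  have "(\<Sum>q<2 ^ Suc j. kaczmarz (p + q) x * kaczmarz (p + q) s) =
      (\<Sum>q<2 ^ j. kaczmarz (p + q) x * kaczmarz (p + q) s) +
      (\<Sum>q<2 ^ j. kaczmarz (p + (2 ^ j + q)) x * kaczmarz (p + (2 ^ j + q)) s)"
    by (simp only: power_Suc mult_2 sum_lessThan_add)
  also have "(\<Sum>q<2 ^ j. kaczmarz (p + (2 ^ j + q)) x * kaczmarz (p + (2 ^ j + q)) s) =
      ?r * (\<Sum>q<2 ^ j. kaczmarz (p + q) x * kaczmarz (p + q) s)"
    unfolding sum_distrib_left by (intro sum.cong) (simp_all only: step lessThan_iff mult_ac)
  also have "(\<Sum>q<2 ^ j. kaczmarz (p + q) x * kaczmarz (p + q) s) + \<dots> =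
      kaczmarz p x * kaczmarz p s * ((1 + ?r) * block_kernel N j x s)"
    using Suc.IH Suc.prems(1) dvd by (simp add: algebra_simps)
  also have "(1 + ?r) * block_kernel N j x s = block_kernel N (Suc j) x s"
  proof -
    have "{N - Suc j..<N} = insert (N - 1 - j) {N - j..<N}" using Suc.prems(1) by auto
    then show ?thesis using Suc.prems(1) by (simp add: block_kernel_def)
  qed
  finally show ?case .
qed

text \<open>The initial range is assembled from the blocks between consecutive powers of 2. The
  result is 2^N times the indicator that \<open>x\<close> and \<open>s\<close> share a dyadic cell
  of rank \<open>N\<close>.\<close>

lemma sum_initial_block:
  "(\<Sum>q<2 ^ N. kaczmarz q x * kaczmarz q s) = block_kernel N N x s"
proof (induction N)
  case 0
  then show ?case by (simp add: block_kernel_def)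
next
  case (Suc N)
  have top: "kaczmarz (2 ^ N) y = rademacher N y" for y
    by (simp add: kaczmarz_def top_bit_eq[of N] bit_exp_iff)
  have "(\<Sum>q<2 ^ Suc N. kaczmarz q x * kaczmarz q s) = (\<Sum>q<2 ^ N. kaczmarz q x * kaczmarz q s) +
      (\<Sum>q<2 ^ N. kaczmarz (2 ^ N + q) x * kaczmarz (2 ^ N + q) s)"
    by (simp only: power_Suc mult_2 sum_lessThan_add)
  also have "(\<Sum>q<2 ^ N. kaczmarz (2 ^ N + q) x * kaczmarz (2 ^ N + q) s) =
      rademacher N x * rademacher N s * block_kernel N N x s"
    using sum_dyadic_block[of N "2 ^ N" N x s] by (simp add: top)
  also have "(\<Sum>q<2 ^ N. kaczmarz q x * kaczmarz q s) + \<dots> = block_kernel (Suc N) (Suc N) x s"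
    unfolding Suc.IH by (simp add: block_kernel_def atLeast0LessThan algebra_simps)
  finally show ?case .
qed

text \<open>Erases the digits \<open>0\<close> to \<open>j\<close> of \<open>n\<close>. If digit
  \<open>j\<close> is set, the block of length 2^j starting here is the piece of
  \<open>{0..<n}\<close> that this digit cuts off.\<close>

definition dyadic_head :: "nat \<Rightarrow> nat \<Rightarrow> nat"
  where "dyadic_head n j = n div 2 ^ Suc j * 2 ^ Suc j"

lemma dyadic_head_bounds:
  assumes "2 ^ N \<le> n" "n < 2 ^ Suc N" "j < N"
  shows "2 ^ N \<le> dyadic_head n j" "dyadic_head n j < 2 ^ Suc N"
proof -
  have "(2::nat) ^ N = 2 ^ (N - Suc j) * 2 ^ Suc j" using assms(3) by (simp flip: power_add power_Suc)
  also have "\<dots> \<le> dyadic_head n j" unfolding dyadic_head_def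
    using assms by (intro mult_le_mono1) (simp add: less_eq_div_iff_mult_less_eq flip: power_add power_Suc)
  finally show "2 ^ N \<le> dyadic_head n j" .
  show "dyadic_head n j < 2 ^ Suc N"
    using assms(2) div_times_less_eq_dividend unfolding dyadic_head_def by (rule order_le_less_trans[rotated])
qed

lemma dyadic_head_top: "n < 2 ^ Suc N \<Longrightarrow> dyadic_head n N = 0"
  by (simp add: dyadic_head_def)

lemma dyadic_head_head: "j \<le> i \<Longrightarrow> dyadic_head (dyadic_head n j) i = dyadic_head n i"
proof -
  assume "j \<le> i"
  then have e: "(2::nat) ^ Suc i = 2 ^ Suc j * 2 ^ (i - j)" by (simp flip: power_add)
  show ?thesis unfolding dyadic_head_def e by (simp add: div_mult2_eq)
qed

lemma dirichlet_kernel_blocks: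
  assumes n: "2 ^ N \<le> n" "n < 2 ^ Suc N"
  shows "(\<Sum>i<n. kaczmarz i x * kaczmarz i s) = (\<Sum>j\<le>N. of_bool (bit n j) *
    (kaczmarz (dyadic_head n j) x * kaczmarz (dyadic_head n j) s * block_kernel N j x s))"
proof -
  let ?D = "\<lambda>m. \<Sum>i<m. kaczmarz i x * kaczmarz i s"
  let ?t = "\<lambda>j. of_bool (bit n j) *
    (kaczmarz (dyadic_head n j) x * kaczmarz (dyadic_head n j) s * block_kernel N j x s)"
  \<comment> \<open>Digits are peeled off from the lowest upwards; what remains is the Dirichlet
    kernel of the truncated index, which is 0 once \<open>J = Suc N\<close>.\<close>
  have "?D n = sum ?t {..<J} + ?D (n div 2 ^ J * 2 ^ J)" if "J \<le> Suc N" for J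
    using that
  proof (induction J)
    case (Suc J)
    have "n div 2 ^ J = 2 * (n div 2 ^ Suc J) + of_bool (bit n J)"
      by (simp only: bit_iff_odd power_Suc2 div_mult2_eq) (simp add: mod_2_eq_odd flip: mod_2_eq_odd)
    then have e: "n div 2 ^ J * 2 ^ J = dyadic_head n J + of_bool (bit n J) * 2 ^ J"
      by (simp add: dyadic_head_def algebra_simps)
    have "?D (n div 2 ^ J * 2 ^ J) = ?D (dyadic_head n J) + ?t J"
    proof (cases "bit n J")
      case True
      have "?D (dyadic_head n J + 2 ^ J) = ?D (dyadic_head n J) +
          (\<Sum>q<2 ^ J. kaczmarz (dyadic_head n J + q) x * kaczmarz (dyadic_head n J + q) s)"
        by (rule sum_lessThan_add)
      moreover have "(\<Sum>q<2 ^ J. kaczmarz (dyadic_head n J + q) x * kaczmarz (dyadic_head n J + q) s) = ?t J"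
      \<comment> \<open>The top digit gives the block starting at 0, where \<open>kaczmarz 0\<close>
        is 1; every lower digit gives a block inside \<open>{2 ^ N..<2 ^ Suc N}\<close>.\<close>
      proof (cases "J = N")
        case True
        then show ?thesis using n \<open>bit n J\<close> by (simp add: dyadic_head_top sum_initial_block)
      next
        case False
        then have "J < N" using Suc.prems by simp
        then show ?thesis using dyadic_head_bounds[OF n] \<open>bit n J\<close>
          by (subst sum_dyadic_block) (auto simp: dyadic_head_def)
      qed
      ultimately show ?thesis using True e by simp
    qed (simp add: e)
    with Suc show ?case by (simp add: dyadic_head_def)
  qed simp
  from this[of "Suc N"] n(2) show ?thesis by (simp add: lessThan_Suc_atMost)
qed

text \<open>Multiplying the kernel by \<open>kaczmarz p\<close> gives a combination of the functions
  with indices from \<open>p\<close> to \<open>p + 2 ^ j - 1\<close>. The only multiple of 2^j among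
  these is \<open>p\<close>, so \<open>p'\<close> is not one of them and orthonormality
  applies.\<close>

lemma integral_kaczmarz_block_kernel:
  assumes p: "2 ^ N \<le> p" "p < 2 ^ Suc N" "2 ^ j dvd p" and "2 ^ j dvd p'" "j \<le> N" "p \<noteq> p'"
  shows "(\<integral>t. kaczmarz p t * kaczmarz p' t * block_kernel N j y t \<partial>walsh_measure) = 0"
proof -
  have ne: "p + q \<noteq> p'" if "q < 2 ^ j" for q
    using assms that by (metis add.right_neutral dvd_add_right_iff nat_dvd_not_less neq0_conv)
  have "kaczmarz p t * kaczmarz p' t * block_kernel N j y t =
      kaczmarz p y * (\<Sum>q<2 ^ j. kaczmarz (p + q) y * (kaczmarz (p + q) t * kaczmarz p' t))" for t
  proof -
    have "kaczmarz p y * (\<Sum>q<2 ^ j. kaczmarz (p + q) y * (kaczmarz (p + q) t * kaczmarz p' t)) =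
        kaczmarz p y * kaczmarz p' t * (\<Sum>q<2 ^ j. kaczmarz (p + q) y * kaczmarz (p + q) t)"
      by (simp add: sum_distrib_left mult_ac)
    also have "\<dots> = (kaczmarz p y * kaczmarz p y) * (kaczmarz p t * kaczmarz p' t * block_kernel N j y t)"
      by (subst sum_dyadic_block) (use assms in \<open>simp_all only: mult_ac\<close>)
    finally show ?thesis by simp
  qed
  then have "(\<integral>t. kaczmarz p t * kaczmarz p' t * block_kernel N j y t \<partial>walsh_measure) =
      kaczmarz p y * (\<Sum>q<2 ^ j. kaczmarz (p + q) y * (\<integral>t. kaczmarz (p + q) t * kaczmarz p' t \<partial>walsh_measure))"
    by (simp add: integrable_walsh continuous_intros)
  then show ?thesis using ne by (simp add: kaczmarz_orthonormal)
qed

section \<open>Bessel estimates for the block coefficients\<close>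

text \<open>The weight is meant for a product of two block kernels: a probability density under
  which the characters at suitable dyadic heads are orthonormal.\<close>

lemma bessel_inequality:
  fixes w g :: "walsh \<times> walsh \<Rightarrow> real" and e :: "'i \<Rightarrow> walsh \<times> walsh \<Rightarrow> real"
  assumes "finite P" and cont: "continuous_on UNIV w" "continuous_on UNIV g" "\<And>p. continuous_on UNIV (e p)"
    and nonneg: "\<And>z. w z \<ge> 0"
    and orth: "\<And>p q. p \<in> P \<Longrightarrow> q \<in> P \<Longrightarrow> (\<integral>z. w z * (e p z * e q z) \<partial>walsh_measure2) = of_bool (p = q)"
  shows "(\<Sum>p\<in>P. (\<integral>z. w z * (g z * e p z) \<partial>walsh_measure2)\<^sup>2) \<le> (\<integral>z. w z * (g z)\<^sup>2 \<partial>walsh_measure2)"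
proof -
  define c where "c p = (\<integral>z. w z * (g z * e p z) \<partial>walsh_measure2)" for p
  have int: "integrable walsh_measure2 (\<lambda>z. w z * (g z)\<^sup>2)"
    "integrable walsh_measure2 (\<lambda>z. w z * (g z * e p z))"
    "integrable walsh_measure2 (\<lambda>z. w z * (e p z * e q z))" for p q
    by (auto intro!: integrable_walsh2 continuous_intros cont)
  \<comment> \<open>Expand the weighted square norm of \<open>g\<close> minus its projection onto
    the span of the \<open>e p\<close>.\<close>
  have "0 \<le> (\<integral>z. w z * (g z - (\<Sum>p\<in>P. c p * e p z))\<^sup>2 \<partial>walsh_measure2)"
    by (intro integral_nonneg_AE AE_I2 mult_nonneg_nonneg nonneg zero_le_power2)
  also have "(\<lambda>z. w z * (g z - (\<Sum>p\<in>P. c p * e p z))\<^sup>2) = (\<lambda>z. w z * (g z)\<^sup>2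
      - 2 * (\<Sum>p\<in>P. c p * (w z * (g z * e p z)))
      + (\<Sum>p\<in>P. \<Sum>q\<in>P. c p * c q * (w z * (e p z * e q z))))"
  proof
    fix z
    define S where "S = (\<Sum>p\<in>P. c p * e p z)"
    have "w z * (g z - S)\<^sup>2 = w z * (g z)\<^sup>2 - 2 * (w z * g z * S) + w z * (S * S)"
      by (simp add: power2_eq_square algebra_simps)
    also have "w z * g z * S = (\<Sum>p\<in>P. c p * (w z * (g z * e p z)))"
      unfolding S_def sum_distrib_left by (simp only: mult_ac)
    also have "w z * (S * S) = (\<Sum>p\<in>P. \<Sum>q\<in>P. c p * c q * (w z * (e p z * e q z)))"
      unfolding S_def sum_product unfolding sum_distrib_left by (simp only: mult_ac)
    finally show "w z * (g z - S)\<^sup>2 = w z * (g z)\<^sup>2 - 2 * (\<Sum>p\<in>P. c p * (w z * (g z * e p z)))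
      + (\<Sum>p\<in>P. \<Sum>q\<in>P. c p * c q * (w z * (e p z * e q z)))" .
  qed
  also have "(\<integral>z. w z * (g z)\<^sup>2 - 2 * (\<Sum>p\<in>P. c p * (w z * (g z * e p z)))
      + (\<Sum>p\<in>P. \<Sum>q\<in>P. c p * c q * (w z * (e p z * e q z))) \<partial>walsh_measure2) =
      (\<integral>z. w z * (g z)\<^sup>2 \<partial>walsh_measure2) - 2 * (\<Sum>p\<in>P. c p * c p)
      + (\<Sum>p\<in>P. \<Sum>q\<in>P. c p * c q * of_bool (p = q))"
    using int by (simp add: c_def orth cong: sum.cong)
  also have "(\<Sum>p\<in>P. \<Sum>q\<in>P. c p * c q * of_bool (p = q)) = (\<Sum>p\<in>P. c p * c p)"
  proof (intro sum.cong refl)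
    fix p assume "p \<in> P"
    then have "P \<inter> {q. p = q} = {p}" by auto
    then show "(\<Sum>q\<in>P. c p * c q * of_bool (p = q)) = c p * c p" using \<open>finite P\<close> by simp
  qed
  finally show ?thesis by (simp add: c_def power2_eq_square)
qed

lemma integral_mult_left_le:
  fixes w h :: "walsh \<times> walsh \<Rightarrow> real"
  assumes "continuous_on UNIV w" "continuous_on UNIV h" "\<And>z. w z \<ge> 0" "\<And>z. \<bar>h z\<bar> \<le> B"
    and "(\<integral>z. w z \<partial>walsh_measure2) = 1"
  shows "\<bar>\<integral>z. w z * h z \<partial>walsh_measure2\<bar> \<le> B"
proof -
  have int: "integrable walsh_measure2 (\<lambda>z. w z * h z)" "integrable walsh_measure2 (\<lambda>z. w z * B)"
    by (auto intro!: integrable_walsh2 continuous_intros assms)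
  have "\<bar>\<integral>z. w z * h z \<partial>walsh_measure2\<bar> \<le> (\<integral>z. \<bar>w z * h z\<bar> \<partial>walsh_measure2)"
    by (rule integral_abs_bound)
  also have "\<dots> \<le> (\<integral>z. w z * B \<partial>walsh_measure2)"
    by (intro integral_mono integrable_abs int)
       (simp add: abs_mult assms mult_left_mono)
  finally show ?thesis using assms(5) integrable_walsh2[OF assms(1)] by simp
qed

text \<open>The contribution of digit \<open>i\<close> in the first variable and digit
  \<open>j\<close> in the second to the partial sum at \<open>(x, y)\<close>, stripped of the digit
  indicators and of the values of modulus one at \<open>x\<close> and \<open>y\<close>.\<close>

definition block_coeff ::
  "nat \<Rightarrow> (walsh \<times> walsh \<Rightarrow> real) \<Rightarrow> walsh \<Rightarrow> walsh \<Rightarrow> nat \<Rightarrow> nat \<Rightarrow> nat \<Rightarrow> real"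
  where "block_coeff N g x y n i j =
    (\<integral>z. (block_kernel N i x (fst z) * block_kernel N j y (snd z)) *
      (g z * (kaczmarz (dyadic_head n i) (fst z) * kaczmarz (dyadic_head n j) (snd z))) \<partial>walsh_measure2)"

lemma integral_block_kernel2:
  "(\<integral>z. block_kernel N i x (fst z) * block_kernel N j y (snd z) \<partial>walsh_measure2) = 1"
  by (subst integral_walsh2_times) (auto intro!: continuous_intros simp: integral_block_kernel)

lemma abs_block_coeff_le:
  assumes "continuous_on UNIV g" "\<And>z. \<bar>g z\<bar> \<le> B"
  shows "\<bar>block_coeff N g x y n i j\<bar> \<le> B"
  unfolding block_coeff_def
  by (intro integral_mult_left_le integral_block_kernel2 continuous_intros mult_nonneg_nonneg block_kernel_nonneg)
     (auto simp: abs_mult assms)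

text \<open>The coefficient depends on \<open>n\<close> only through \<open>dyadic_head n m\<close>
  with \<open>m = min i j\<close>. Bessel bounds the sum over the distinct heads by 1, and at most
  2^(m+1) indices share a head.\<close>

lemma sum_block_coeff_squared_le:
  assumes g: "continuous_on UNIV g" "\<And>z. \<bar>g z\<bar> \<le> 1" and ij: "i \<le> N" "j \<le> N"
  shows "(\<Sum>n\<in>{2 ^ N..<2 ^ Suc N}. (block_coeff N g x y n i j)\<^sup>2) \<le> 2 ^ Suc (min i j)"
proof -
  define m where "m = min i j"
  define P where "P = (\<lambda>n. dyadic_head n m) ` {2 ^ N..<2 ^ Suc N}"
  define w where "w z = block_kernel N i x (fst z) * block_kernel N j y (snd z)" for z
  define e where "e p z = kaczmarz (dyadic_head p i) (fst z) * kaczmarz (dyadic_head p j) (snd z)"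
    for p and z :: "walsh \<times> walsh"
  have cont: "continuous_on UNIV w" "continuous_on UNIV (e p)" for p
    unfolding w_def e_def by (intro continuous_intros)+
  have dvd: "2 ^ m dvd dyadic_head p m" for p
    unfolding dyadic_head_def by simp
  have P: "dyadic_head p m = p" if "p \<in> P" for p
    using that by (auto simp: P_def dyadic_head_head)
  have orth1: "(\<integral>t. kaczmarz p t * kaczmarz q t * block_kernel N m u t \<partial>walsh_measure) = 0"
    if "p \<in> P" "q \<in> P" "p \<noteq> q" for p q u
  proof -
    \<comment> \<open>For \<open>m = N\<close> every head is 0, so \<open>P\<close> has no two
      distinct elements.\<close>
    have "m \<noteq> N" using that by (auto simp: P_def dyadic_head_top)
    then have "m < N" using ij by (simp add: m_def)
    moreover have "2 ^ N \<le> p" "p < 2 ^ Suc N"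
      using \<open>p \<in> P\<close> dyadic_head_bounds[OF _ _ \<open>m < N\<close>] by (auto simp: P_def)
    moreover have "2 ^ m dvd p" "2 ^ m dvd q" using dvd P that by metis+
    ultimately show ?thesis using that by (intro integral_kaczmarz_block_kernel) auto
  qed
  have orth: "(\<integral>z. w z * (e p z * e q z) \<partial>walsh_measure2) = of_bool (p = q)"
    if pq: "p \<in> P" "q \<in> P" for p q
  proof (cases "p = q")
    case True
    have "e p z * e p z = (kaczmarz (dyadic_head p i) (fst z) * kaczmarz (dyadic_head p i) (fst z)) *
        (kaczmarz (dyadic_head p j) (snd z) * kaczmarz (dyadic_head p j) (snd z))" for z
      by (simp only: e_def mult_ac)
    then have "e p z * e p z = 1" for z by simp
    then show ?thesis using True by (simp add: w_def integral_block_kernel2)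
  next
    case False
    have "(\<integral>z. w z * (e p z * e q z) \<partial>walsh_measure2) =
      (\<integral>z. (kaczmarz (dyadic_head p i) (fst z) * kaczmarz (dyadic_head q i) (fst z) * block_kernel N i x (fst z)) *
        (kaczmarz (dyadic_head p j) (snd z) * kaczmarz (dyadic_head q j) (snd z) * block_kernel N j y (snd z)) \<partial>walsh_measure2)"
      by (simp add: w_def e_def mult_ac)
    also have "\<dots> =
      (\<integral>s. kaczmarz (dyadic_head p i) s * kaczmarz (dyadic_head q i) s * block_kernel N i x s \<partial>walsh_measure) *
      (\<integral>t. kaczmarz (dyadic_head p j) t * kaczmarz (dyadic_head q j) t * block_kernel N j y t \<partial>walsh_measure)"
      by (intro integral_walsh2_times continuous_intros)
    \<comment> \<open>One vanishing factor suffices: in the variable with the smaller digit position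
      the heads are \<open>p\<close> and \<open>q\<close> themselves.\<close>
    also have "\<dots> = 0"
      using orth1[OF pq False] P[OF pq(1)] P[OF pq(2)] by (cases "i \<le> j") (auto simp: m_def)
    finally show ?thesis using False by simp
  qed
  define Y where "Y p = (\<integral>z. w z * (g z * e p z) \<partial>walsh_measure2)" for p
  have XY: "block_coeff N g x y n i j = Y (dyadic_head n m)" for n
    by (simp add: block_coeff_def Y_def w_def e_def dyadic_head_head m_def)
  have "(\<Sum>p\<in>P. (Y p)\<^sup>2) \<le> (\<integral>z. w z * (g z)\<^sup>2 \<partial>walsh_measure2)"
    unfolding Y_def
  proof (rule bessel_inequality[OF _ cont(1) g(1) cont(2) _ orth])
    show "finite P" by (simp add: P_def)
    show "w z \<ge> 0" for z by (simp add: w_def block_kernel_nonneg)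
  qed
  also have "\<dots> \<le> 1"
  proof -
    have "\<bar>\<integral>z. w z * (g z)\<^sup>2 \<partial>walsh_measure2\<bar> \<le> 1"
      by (intro integral_mult_left_le continuous_intros cont g)
         (auto simp: w_def block_kernel_nonneg integral_block_kernel2 abs_square_le_1 g)
    then show ?thesis by simp
  qed
  finally have Y: "(\<Sum>p\<in>P. (Y p)\<^sup>2) \<le> 1" .
  have "(\<Sum>n\<in>{2 ^ N..<2 ^ Suc N}. (block_coeff N g x y n i j)\<^sup>2) =
      (\<Sum>p\<in>P. \<Sum>n\<in>{n \<in> {2 ^ N..<2 ^ Suc N}. dyadic_head n m = p}. (Y p)\<^sup>2)"
    unfolding P_def XY by (subst sum.image_gen[where g = "\<lambda>n. dyadic_head n m"]) (auto intro!: sum.cong)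
  also have "\<dots> \<le> (\<Sum>p\<in>P. 2 ^ Suc m * (Y p)\<^sup>2)"
  proof (rule sum_mono)
    fix p
    \<comment> \<open>Indices with a common head share their quotient by 2^(m+1).\<close>
    have "{n \<in> {2 ^ N..<2 ^ Suc N}. dyadic_head n m = p} \<subseteq> {p..<p + 2 ^ Suc m}"
    proof
      fix n assume "n \<in> {n \<in> {2 ^ N..<2 ^ Suc N}. dyadic_head n m = p}"
      then have "n div 2 ^ Suc m * 2 ^ Suc m = p" by (simp add: dyadic_head_def)
      moreover have "n div 2 ^ Suc m * 2 ^ Suc m + n mod 2 ^ Suc m = n" by (rule div_mult_mod_eq)
      moreover have "n mod 2 ^ Suc m < 2 ^ Suc m" by (intro mod_less_divisor) simp
      ultimately show "n \<in> {p..<p + 2 ^ Suc m}" unfolding atLeastLessThan_iff by linarith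
    qed
    then have "card {n \<in> {2 ^ N..<2 ^ Suc N}. dyadic_head n m = p} \<le> card {p..<p + 2 ^ Suc m}"
      by (intro card_mono) auto
    then have "real (card {n \<in> {2 ^ N..<2 ^ Suc N}. dyadic_head n m = p}) \<le> real (2 ^ Suc m)"
      unfolding card_atLeastLessThan by (intro of_nat_mono) simp
    then show "(\<Sum>n\<in>{n \<in> {2 ^ N..<2 ^ Suc N}. dyadic_head n m = p}. (Y p)\<^sup>2) \<le> 2 ^ Suc m * (Y p)\<^sup>2"
      unfolding sum_constant by (intro mult_right_mono) auto
  qed
  also have "\<dots> \<le> 2 ^ Suc m"
    using Y by (simp flip: sum_distrib_left)
  finally show ?thesis by (simp add: m_def)
qed

section \<open>Partial sums in terms of block coefficients\<close>

lemma kaczmarz_sum_eq_integral: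
  assumes "continuous_on UNIV g"
  shows "kaczmarz_sum n m g (x, y) = (\<integral>z. g z * ((\<Sum>k<n. kaczmarz k x * kaczmarz k (fst z)) *
    (\<Sum>i<m. kaczmarz i y * kaczmarz i (snd z))) \<partial>walsh_measure2)"
proof -
  have int: "integrable walsh_measure2 (\<lambda>z. g z * kaczmarz k (fst z) * kaczmarz i (snd z))" for k i
    by (intro integrable_walsh2 continuous_intros assms)
  have rearrange: "g z * (kaczmarz k x * kaczmarz k (fst z) * (kaczmarz i y * kaczmarz i (snd z))) =
      g z * kaczmarz k (fst z) * kaczmarz i (snd z) * kaczmarz k x * kaczmarz i y" for z k i
    by (simp only: mult_ac)
  have "kaczmarz_sum n m g (x, y) = (\<integral>z. (\<Sum>k<n. \<Sum>i<m. g z * kaczmarz k (fst z) * kaczmarz i (snd z)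
      * kaczmarz k x * kaczmarz i y) \<partial>walsh_measure2)"
    using int by (simp add: kaczmarz_sum_def kaczmarz_coeff_def case_prod_unfold)
  also have "\<dots> = (\<integral>z. g z * ((\<Sum>k<n. kaczmarz k x * kaczmarz k (fst z)) *
    (\<Sum>i<m. kaczmarz i y * kaczmarz i (snd z))) \<partial>walsh_measure2)"
    unfolding sum_product unfolding sum_distrib_left
    by (simp only: rearrange)
  finally show ?thesis .
qed

lemma abs_kaczmarz_sum_le:
  assumes g: "continuous_on UNIV g" and n: "2 ^ N \<le> n" "n < 2 ^ Suc N"
  shows "\<bar>kaczmarz_sum n n g (x, y)\<bar> \<le> (\<Sum>i\<le>N. \<Sum>j\<le>N. \<bar>block_coeff N g x y n i j\<bar>)"
proof -
  define a where "a i u = of_bool (bit n i) * kaczmarz (dyadic_head n i) u" for i u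
  define T where "T i j z = (block_kernel N i x (fst z) * block_kernel N j y (snd z)) *
      (g z * (kaczmarz (dyadic_head n i) (fst z) * kaczmarz (dyadic_head n j) (snd z)))" for i j z
  have int: "integrable walsh_measure2 (T i j)" for i j
    unfolding T_def[abs_def] by (intro integrable_walsh2 continuous_intros g)
  have rearrange: "g z * (of_bool (bit n i) * (kaczmarz (dyadic_head n i) x * kaczmarz (dyadic_head n i) (fst z) *
      block_kernel N i x (fst z)) * (of_bool (bit n j) * (kaczmarz (dyadic_head n j) y *
      kaczmarz (dyadic_head n j) (snd z) * block_kernel N j y (snd z)))) = a i x * a j y * T i j z" for i j z
    by (simp only: a_def T_def mult_ac)
  have "kaczmarz_sum n n g (x, y) = (\<integral>z. (\<Sum>i\<le>N. \<Sum>j\<le>N. a i x * a j y * T i j z) \<partial>walsh_measure2)"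
    unfolding kaczmarz_sum_eq_integral[OF g] dirichlet_kernel_blocks[OF n] sum_product
    unfolding sum_distrib_left
    by (simp only: rearrange)
  also have "\<dots> = (\<Sum>i\<le>N. \<Sum>j\<le>N. a i x * a j y * (\<integral>z. T i j z \<partial>walsh_measure2))"
    using int by simp
  also have "\<dots> = (\<Sum>i\<le>N. \<Sum>j\<le>N. a i x * a j y * block_coeff N g x y n i j)"
    by (simp add: T_def[abs_def] block_coeff_def)
  finally have "\<bar>kaczmarz_sum n n g (x, y)\<bar> \<le> (\<Sum>i\<le>N. \<Sum>j\<le>N. \<bar>a i x * a j y * block_coeff N g x y n i j\<bar>)"
    by (auto intro!: order_trans[OF sum_abs] sum_mono)
  also have "\<dots> \<le> (\<Sum>i\<le>N. \<Sum>j\<le>N. \<bar>block_coeff N g x y n i j\<bar>)"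
    by (intro sum_mono) (auto simp: abs_mult a_def)
  finally show ?thesis .
qed

section \<open>Exponential integrability of the partial sums over a dyadic block\<close>

text \<open>With \<open>K\<close> minimal such that the part of the sum at levels \<open>\<ge> K\<close> is at most \<open>1\<close>, the whole sum
  is at most \<open>K\<^sup>2 + 1\<close>; minimality makes the tail at \<open>K - 1\<close> exceed \<open>1\<close>, which pays for the
  exponential.\<close>

lemma exp_sqrt_sum_le:
  fixes X :: "nat \<Rightarrow> nat \<Rightarrow> real" and a :: real
  assumes X: "\<And>i j. 0 \<le> X i j" "\<And>i j. X i j \<le> 1" and "a \<ge> 0"
  shows "exp (a * sqrt (\<Sum>i\<le>N. \<Sum>j\<le>N. X i j)) \<le>
    exp a + (\<Sum>K\<le>N. exp (a * (real K + 2)) * (\<Sum>i\<le>N. \<Sum>j\<le>N. of_bool (K \<le> max i j) * X i j))"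
proof -
  define R where "R K = (\<Sum>i\<le>N. \<Sum>j\<le>N. of_bool (K \<le> max i j) * X i j)" for K
  have R_nonneg: "R K \<ge> 0" for K
    unfolding R_def by (intro sum_nonneg) (simp add: X)
  define K where "K = (LEAST K. R K \<le> 1)"
  have "R (Suc N) \<le> 1"
    unfolding R_def by (auto intro!: sum_nonpos order_trans[OF _ zero_le_one])
  then have K: "R K \<le> 1" "K \<le> Suc N"
    unfolding K_def by (auto intro: LeastI Least_le)
  have "(\<Sum>i\<le>N. \<Sum>j\<le>N. X i j) \<le> (\<Sum>i\<le>N. \<Sum>j\<le>N. of_bool (K \<le> max i j) * X i j + of_bool (i < K) * of_bool (j < K))"
    by (intro sum_mono) (use X in auto)
  also have "\<dots> = R K + (\<Sum>i\<le>N. of_bool (i < K)) * (\<Sum>j\<le>N. of_bool (j < K))"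
    by (simp only: R_def sum.distrib sum_product)
  also have "(\<Sum>i\<le>N. of_bool (i < K) :: real) \<le> K"
  proof -
    have "(\<Sum>i\<le>N. of_bool (i < K) :: real) = card ({..N} \<inter> {i. i < K})" by simp
    also have "\<dots> \<le> card {..<K}" by (intro of_nat_mono card_mono) auto
    finally show ?thesis by simp
  qed
  then have "R K + (\<Sum>i\<le>N. of_bool (i < K)) * (\<Sum>j\<le>N. of_bool (j < K)) \<le> 1 + real K * real K"
    using K(1) by (intro add_mono mult_mono) (auto intro!: sum_nonneg)
  also have "\<dots> \<le> (real K + 1)\<^sup>2" by (simp add: power2_eq_square algebra_simps)
  finally have "sqrt (\<Sum>i\<le>N. \<Sum>j\<le>N. X i j) \<le> real K + 1"
    by (intro real_le_lsqrt) (auto intro!: sum_nonneg X)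
  then have le: "exp (a * sqrt (\<Sum>i\<le>N. \<Sum>j\<le>N. X i j)) \<le> exp (a * (real K + 1))"
    using \<open>a \<ge> 0\<close> by (simp add: mult_left_mono)
  also have "\<dots> \<le> exp a + (\<Sum>K\<le>N. exp (a * (real K + 2)) * R K)"
  proof (cases K)
    case 0
    then show ?thesis by (simp add: sum_nonneg R_nonneg)
  next
    case (Suc L)
    then have "\<not> R L \<le> 1" using not_less_Least[of L "\<lambda>K. R K \<le> 1"] by (simp add: K_def)
    \<comment> \<open>Here \<open>K = Suc L\<close>, so \<open>real K + 1 = real L + 2\<close>; this
      is the origin of the 2 in the exponent of the statement.\<close>
    then have "exp (a * (real K + 1)) \<le> exp (a * (real L + 2)) * R L"
      using Suc by (simp add: add.commute)
    also have "\<dots> \<le> (\<Sum>K\<le>N. exp (a * (real K + 2)) * R K)"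
      using K(2) Suc by (intro member_le_sum) (auto simp: R_nonneg)
    finally show ?thesis by (simp add: add_increasing)
  qed
  finally show ?thesis by (simp add: R_def)
qed

text \<open>The pointwise bound is summed over \<open>B\<close>. A pair with
  \<open>m = max i j\<close> is met by every threshold \<open>K\<close> up to \<open>m\<close>, at a
  cost of order (m+1) e^(a m), while its mean decays like 2^(-m/2). The condition on
  \<open>\<sigma>\<close> says that e^a is below sqrt 2, so the decay wins.\<close>

lemma sum_exp_sqrt_le:
  fixes X :: "'n \<Rightarrow> nat \<Rightarrow> nat \<Rightarrow> real" and a :: real
  defines "\<sigma> \<equiv> sqrt (exp a / sqrt 2)"
  assumes X: "\<And>n i j. 0 \<le> X n i j" "\<And>n i j. X n i j \<le> 1"
    and a: "a \<ge> 0" "\<sigma> < 1" and "finite B"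
    and square: "\<And>i j. i \<le> N \<Longrightarrow> j \<le> N \<Longrightarrow> (\<Sum>n\<in>B. (X n i j)\<^sup>2) \<le> 2 * card B / 2 ^ max i j"
  shows "(\<Sum>n\<in>B. exp (a * sqrt (\<Sum>i\<le>N. \<Sum>j\<le>N. X n i j))) \<le>
    (exp a + sqrt 2 * exp (2 * a) * (1 / (1 - \<sigma>)\<^sup>2)\<^sup>2) * card B"
proof -
  define \<rho> where "\<rho> = exp a / sqrt 2"
  have \<sigma>: "\<sigma> \<ge> 0" "\<sigma>\<^sup>2 = \<rho>" by (simp_all add: \<sigma>_def \<rho>_def)
  \<comment> \<open>Cauchy-Schwarz turns the bound on the mean square into one on the mean.\<close>
  have mean: "(\<Sum>n\<in>B. X n i j) \<le> card B * sqrt 2 / sqrt 2 ^ max i j" if "i \<le> N" "j \<le> N" for i j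
  proof (rule power2_le_imp_le)
    have "(\<Sum>n\<in>B. X n i j)\<^sup>2 \<le> (\<Sum>n\<in>B. (X n i j)\<^sup>2) * card B"
      by (rule sum_squared_le_sum_of_squares)
    also have "\<dots> \<le> 2 * card B / 2 ^ max i j * card B"
      by (intro mult_right_mono square that) auto
    also have "\<dots> = (card B * sqrt 2 / sqrt 2 ^ max i j)\<^sup>2"
      by (simp add: power_divide power_mult_distrib power2_eq_square flip: power_mult_distrib)
    finally show "(\<Sum>n\<in>B. X n i j)\<^sup>2 \<le> (card B * sqrt 2 / sqrt 2 ^ max i j)\<^sup>2" .
  qed simp
  have "(\<Sum>n\<in>B. exp (a * sqrt (\<Sum>i\<le>N. \<Sum>j\<le>N. X n i j))) \<le>
      (\<Sum>n\<in>B. exp a + (\<Sum>K\<le>N. exp (a * (real K + 2)) * (\<Sum>i\<le>N. \<Sum>j\<le>N. of_bool (K \<le> max i j) * X n i j)))"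
    by (intro sum_mono exp_sqrt_sum_le X a)
  also have "\<dots> = card B * exp a +
      (\<Sum>i\<le>N. \<Sum>j\<le>N. (\<Sum>K\<le>N. exp (a * (real K + 2)) * of_bool (K \<le> max i j)) * (\<Sum>n\<in>B. X n i j))"
  proof -
    have "(\<Sum>n\<in>B. \<Sum>K\<le>N. exp (a * (real K + 2)) * (\<Sum>i\<le>N. \<Sum>j\<le>N. of_bool (K \<le> max i j) * X n i j)) =
        (\<Sum>n\<in>B. \<Sum>K\<le>N. \<Sum>i\<le>N. \<Sum>j\<le>N. exp (a * (real K + 2)) * of_bool (K \<le> max i j) * X n i j)"
      unfolding sum_distrib_left by (simp only: mult.assoc)
    also have "\<dots> = (\<Sum>n\<in>B. \<Sum>i\<le>N. \<Sum>K\<le>N. \<Sum>j\<le>N. exp (a * (real K + 2)) * of_bool (K \<le> max i j) * X n i j)"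
      by (intro sum.cong refl sum.swap)
    also have "\<dots> = (\<Sum>i\<le>N. \<Sum>n\<in>B. \<Sum>K\<le>N. \<Sum>j\<le>N. exp (a * (real K + 2)) * of_bool (K \<le> max i j) * X n i j)"
      by (rule sum.swap)
    also have "\<dots> = (\<Sum>i\<le>N. \<Sum>n\<in>B. \<Sum>j\<le>N. \<Sum>K\<le>N. exp (a * (real K + 2)) * of_bool (K \<le> max i j) * X n i j)"
      by (intro sum.cong refl sum.swap)
    also have "\<dots> = (\<Sum>i\<le>N. \<Sum>j\<le>N. \<Sum>n\<in>B. \<Sum>K\<le>N. exp (a * (real K + 2)) * of_bool (K \<le> max i j) * X n i j)"
      by (intro sum.cong refl sum.swap)
    also have "\<dots> = (\<Sum>i\<le>N. \<Sum>j\<le>N. (\<Sum>K\<le>N. exp (a * (real K + 2)) * of_bool (K \<le> max i j)) * (\<Sum>n\<in>B. X n i j))"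
      unfolding sum_product by (intro sum.cong refl sum.swap)
    finally show ?thesis by (simp add: sum.distrib)
  qed
  also have "\<dots> \<le> card B * exp a + (\<Sum>i\<le>N. \<Sum>j\<le>N. (card B * sqrt 2 * exp (2 * a)) *
      ((real (Suc i) * \<sigma> ^ i) * (real (Suc j) * \<sigma> ^ j)))"
  proof (intro add_left_mono sum_mono)
    fix i j assume "i \<in> {..N}" "j \<in> {..N}"
    then have ij: "i \<le> N" "j \<le> N" by auto
    define m where "m = max i j"
    have "(\<Sum>K\<le>N. exp (a * (real K + 2)) * of_bool (K \<le> m)) = (\<Sum>K\<le>m. exp (a * (real K + 2)))"
      using ij by (intro sum.mono_neutral_cong_right) (auto simp: m_def)
    also have "\<dots> \<le> (\<Sum>K\<le>m. exp (a * real m) * exp (2 * a))"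
      using a(1) by (intro sum_mono) (auto simp: distrib_left mult_left_mono simp flip: exp_add)
    also have "\<dots> = real (Suc m) * exp a ^ m * exp (2 * a)"
      by (simp add: exp_of_nat_mult mult.commute[of a])
    finally have "(\<Sum>K\<le>N. exp (a * (real K + 2)) * of_bool (K \<le> m)) * (\<Sum>n\<in>B. X n i j) \<le>
        (real (Suc m) * exp a ^ m * exp (2 * a)) * (card B * sqrt 2 / sqrt 2 ^ m)"
      using mean[OF ij] by (intro mult_mono) (auto simp: m_def sum_nonneg X)
    also have "\<dots> = (card B * sqrt 2 * exp (2 * a)) * (real (Suc m) * \<rho> ^ m)"
      by (simp add: \<rho>_def power_divide)
    \<comment> \<open>Since \<open>\<sigma>\<close> is the square root of \<open>\<rho>\<close> and
      \<open>2 * m \<ge> i + j\<close>, the power splits over the two indices and the double sum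
      becomes the square of a single series.\<close>
    also have "real (Suc m) * \<rho> ^ m \<le> (real (Suc i) * \<sigma> ^ i) * (real (Suc j) * \<sigma> ^ j)"
    proof -
      have "\<rho> ^ m = \<sigma> ^ (2 * m)" using \<sigma> by (simp add: power_mult)
      also have "\<dots> \<le> \<sigma> ^ (i + j)" using \<sigma> a(2) by (intro power_decreasing) (auto simp: m_def)
      finally have "\<rho> ^ m \<le> \<sigma> ^ i * \<sigma> ^ j" by (simp add: power_add)
      moreover have "real (Suc m) \<le> real (Suc i) * real (Suc j)"
        unfolding of_nat_mult[symmetric] of_nat_le_iff by (auto simp: m_def max_def)
      ultimately have "real (Suc m) * \<rho> ^ m \<le> (real (Suc i) * real (Suc j)) * (\<sigma> ^ i * \<sigma> ^ j)"
        by (intro mult_mono) (auto simp: \<rho>_def)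
      then show ?thesis by (simp only: mult_ac)
    qed
    finally show "(\<Sum>K\<le>N. exp (a * (real K + 2)) * of_bool (K \<le> max i j)) * (\<Sum>n\<in>B. X n i j) \<le>
        (card B * sqrt 2 * exp (2 * a)) * ((real (Suc i) * \<sigma> ^ i) * (real (Suc j) * \<sigma> ^ j))"
      by (simp add: m_def mult_left_mono)
  qed
  also have "\<dots> = card B * exp a + (card B * sqrt 2 * exp (2 * a)) * (\<Sum>i\<le>N. real (Suc i) * \<sigma> ^ i)\<^sup>2"
    unfolding power2_eq_square sum_product unfolding sum_distrib_left ..
  also have "\<dots> \<le> card B * exp a + (card B * sqrt 2 * exp (2 * a)) * (1 / (1 - \<sigma>)\<^sup>2)\<^sup>2"
  proof -
    have "(\<lambda>i. real (Suc i) * \<sigma> ^ i) sums (1 / (1 - \<sigma>)\<^sup>2)"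
      using geometric_deriv_sums[of \<sigma>] \<sigma>(1) a(2) by simp
    then have "(\<Sum>i\<le>N. real (Suc i) * \<sigma> ^ i) \<le> 1 / (1 - \<sigma>)\<^sup>2"
      using sum_le_suminf[of "\<lambda>i. real (Suc i) * \<sigma> ^ i" "{..N}"] \<sigma>(1)
      by (auto simp: sums_iff)
    then show ?thesis
      using \<sigma>(1) by (intro add_left_mono mult_left_mono power_mono) (auto intro!: sum_nonneg)
  qed
  finally show ?thesis by (simp add: algebra_simps)
qed

lemma strong_exponential_bound:
  obtains C where "C > 0"
    "\<And>N g z. \<lbrakk>continuous_on UNIV g; \<And>z. \<bar>g z\<bar> \<le> 1\<rbrakk> \<Longrightarrow>
      (\<Sum>n\<in>{2 ^ N..<2 ^ Suc N}. exp (1/4 * sqrt \<bar>kaczmarz_sum n n g z\<bar>)) \<le> C * 2 ^ N"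
proof
  define \<sigma> :: real where "\<sigma> = sqrt (exp (1/4) / sqrt 2)"
  define C where "C = exp (1/4) + sqrt 2 * exp (2 * (1/4)) * (1 / (1 - \<sigma>)\<^sup>2)\<^sup>2"
  \<comment> \<open>The value 1/4 is small enough: its requirement \<open>\<sigma> < 1\<close>
    amounts to e < 4.\<close>
  have "exp (1/4) ^ 4 < sqrt (2::real) ^ 4"
  proof -
    have "exp (1/4 :: real) ^ 4 = exp 1" by (simp flip: exp_of_nat_mult)
    moreover have "sqrt 2 ^ 4 = (4 :: real)" using power_mult[of "sqrt 2" 2 2] by simp
    ultimately show ?thesis using exp_le by simp
  qed
  then have "exp (1/4) < sqrt (2::real)" by (rule power_less_imp_less_base) simp
  then have \<sigma>: "\<sigma> < 1" by (simp add: \<sigma>_def)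
  show "C > 0" unfolding C_def by (intro add_pos_nonneg) auto
  fix N :: nat and g :: "walsh \<times> walsh \<Rightarrow> real" and z :: "walsh \<times> walsh"
  assume g: "continuous_on UNIV g" "\<And>z. \<bar>g z\<bar> \<le> 1"
  obtain x y where z: "z = (x, y)" by (cases z)
  \<comment> \<open>Digit positions are counted from the top, which turns the growth 2^(min i j) of
    the Bessel bound into decay 2^(-max i j) relative to the block length.\<close>
  define X where "X n i j = \<bar>block_coeff N g x y n (N - i) (N - j)\<bar>" for n i j
  let ?B = "{2 ^ N..<2 ^ Suc N} :: nat set"
  have rev: "(\<Sum>i\<le>N. h (N - i)) = (\<Sum>i\<le>N. h i)" for h :: "nat \<Rightarrow> real"
    using sum.nat_diff_reindex[of h "Suc N"] by (simp add: lessThan_Suc_atMost)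
  have "(\<Sum>n\<in>?B. exp (1/4 * sqrt \<bar>kaczmarz_sum n n g z\<bar>)) \<le>
      (\<Sum>n\<in>?B. exp (1/4 * sqrt (\<Sum>i\<le>N. \<Sum>j\<le>N. X n i j)))"
  proof (rule sum_mono)
    fix n :: nat assume "n \<in> ?B"
    then have "\<bar>kaczmarz_sum n n g z\<bar> \<le> (\<Sum>i\<le>N. \<Sum>j\<le>N. \<bar>block_coeff N g x y n i j\<bar>)"
      unfolding z by (intro abs_kaczmarz_sum_le g) auto
    also have "\<dots> = (\<Sum>i\<le>N. \<Sum>j\<le>N. X n i j)"
      unfolding X_def using rev[of "\<lambda>j. \<bar>block_coeff N g x y n i j\<bar>" for i]
        rev[of "\<lambda>i. \<Sum>j\<le>N. \<bar>block_coeff N g x y n i j\<bar>"] by simp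
    finally show "exp (1/4 * sqrt \<bar>kaczmarz_sum n n g z\<bar>) \<le> exp (1/4 * sqrt (\<Sum>i\<le>N. \<Sum>j\<le>N. X n i j))"
      by simp
  qed
  also have "\<dots> \<le> C * card ?B"
    unfolding C_def \<sigma>_def
  proof (intro sum_exp_sqrt_le)
    show "sqrt (exp (1/4) / sqrt 2) < (1::real)" using \<sigma> by (simp add: \<sigma>_def)
    fix i j assume ij: "i \<le> N" "j \<le> N"
    have "(\<Sum>n\<in>?B. (X n i j)\<^sup>2) \<le> 2 ^ Suc (min (N - i) (N - j))"
      unfolding X_def power2_abs by (intro sum_block_coeff_squared_le g) auto
    also have "min (N - i) (N - j) = N - max i j" by auto
    also have "(2::real) ^ Suc (N - max i j) = 2 * card ?B / 2 ^ max i j"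
      using ij by (simp add: power_diff)
    finally show "(\<Sum>n\<in>?B. (X n i j)\<^sup>2) \<le> 2 * card ?B / 2 ^ max i j" .
  qed (auto simp: X_def intro: abs_block_coeff_le g)
  finally show "(\<Sum>n\<in>?B. exp (1/4 * sqrt \<bar>kaczmarz_sum n n g z\<bar>)) \<le> C * 2 ^ N" by simp
qed

section \<open>Dyadic partial sums and best approximation\<close>

lemma kaczmarz_eqI:
  assumes "j < 2 ^ N" "\<And>l. l < N \<Longrightarrow> x l = s l"
  shows "kaczmarz j x = kaczmarz j s"
  unfolding kaczmarz_eq_prod[OF assms(1)] using assms(2)
  by (intro prod.cong) (simp_all add: rademacher_def)

lemma block_kernel_eq_0:
  assumes "l < N" "x l \<noteq> s l"
  shows "block_kernel N N x s = 0"
  unfolding block_kernel_def using assms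
  by (intro prod_zero) (auto simp: rademacher_def intro!: bexI[of _ l])

text \<open>The kernel \<open>block_kernel N N\<close> vanishes off the dyadic cell and has integral
  1, so the partial sum is the average of \<open>f\<close> over the product cell of
  \<open>(x, y)\<close>.\<close>

lemma dyadic_partial_sum_near:
  assumes f: "continuous_on UNIV f" and "\<delta> \<ge> 0"
    and near: "\<And>s t. \<lbrakk>\<And>l. l < N \<Longrightarrow> x l = s l; \<And>l. l < N \<Longrightarrow> y l = t l\<rbrakk> \<Longrightarrow> \<bar>f (s, t) - f (x, y)\<bar> \<le> \<delta>"
  shows "\<bar>f (x, y) - kaczmarz_sum (2 ^ N) (2 ^ N) f (x, y)\<bar> \<le> \<delta>"
proof -
  define w where "w z = block_kernel N N x (fst z) * block_kernel N N y (snd z)" for z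
  have w: "w z \<ge> 0" "(\<integral>z. w z \<partial>walsh_measure2) = 1" for z
    by (simp_all add: w_def block_kernel_nonneg integral_block_kernel2)
  have cont: "continuous_on UNIV w"
    unfolding w_def by (intro continuous_intros)
  have int: "integrable walsh_measure2 (\<lambda>z. w z * f z)" "integrable walsh_measure2 (\<lambda>z. w z * c)"
    "integrable walsh_measure2 (\<lambda>z. w z * (f z - c))" for c
    by (intro integrable_walsh2 continuous_intros f cont)+
  have "kaczmarz_sum (2 ^ N) (2 ^ N) f (x, y) = (\<integral>z. w z * f z \<partial>walsh_measure2)"
    by (simp add: kaczmarz_sum_eq_integral[OF f] sum_initial_block w_def mult_ac)
  then have "kaczmarz_sum (2 ^ N) (2 ^ N) f (x, y) - f (x, y) =
      (\<integral>z. w z * f z \<partial>walsh_measure2) - (\<integral>z. w z * f (x, y) \<partial>walsh_measure2)"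
    using w(2) by simp
  also have "\<dots> = (\<integral>z. w z * (f z - f (x, y)) \<partial>walsh_measure2)"
    unfolding right_diff_distrib by (rule Bochner_Integration.integral_diff[symmetric]) (rule int)+
  finally have "\<bar>kaczmarz_sum (2 ^ N) (2 ^ N) f (x, y) - f (x, y)\<bar> \<le> (\<integral>z. \<bar>w z * (f z - f (x, y))\<bar> \<partial>walsh_measure2)"
    by simp
  also have "\<dots> \<le> (\<integral>z. w z * \<delta> \<partial>walsh_measure2)"
  proof (intro integral_mono integrable_abs int)
    fix z :: "walsh \<times> walsh"
    show "\<bar>w z * (f z - f (x, y))\<bar> \<le> w z * \<delta>"
    proof (cases "w z = 0")
      case False
      then have "\<bar>f (fst z, snd z) - f (x, y)\<bar> \<le> \<delta>"
        unfolding w_def using block_kernel_eq_0[of _ N x "fst z"] block_kernel_eq_0[of _ N y "snd z"]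
        by (intro near) auto
      then show ?thesis using w(1)[of z] by (simp add: abs_mult mult_left_mono)
    qed simp
  qed
  also have "\<dots> = \<delta>" using w(2) by simp
  finally show ?thesis by (simp add: abs_minus_commute)
qed

lemma continuous_on_kaczmarz_sum [continuous_intros]:
  assumes "continuous_on S g"
  shows "continuous_on S (\<lambda>z. kaczmarz_sum n m f (g z))"
  unfolding kaczmarz_sum_def case_prod_unfold by (intro continuous_intros assms)

text \<open>Uniform continuity by compactness: finitely many cylinders cover the group, on each of
  which \<open>f\<close> stays within half of \<open>\<epsilon>\<close> of its value at the centre.
  Once \<open>N\<close> reaches all their ranks, every cell of rank \<open>N\<close> lies inside one
  of them.\<close>

lemma dyadic_partial_sums_converge:
  assumes f: "continuous_on UNIV f" and "\<epsilon> > 0"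
  shows "\<exists>N0. \<forall>N\<ge>N0. \<forall>z. \<bar>f z - kaczmarz_sum (2 ^ N) (2 ^ N) f z\<bar> \<le> \<epsilon>"
proof -
  define cyl :: "nat \<Rightarrow> walsh \<times> walsh \<Rightarrow> (walsh \<times> walsh) set"
    where "cyl N z = {u. (\<forall>l<N. fst u l = fst z l) \<and> (\<forall>l<N. snd u l = snd z l)}" for N z
  have open1: "open {u :: walsh. \<forall>l<N. u l = x l}" for N x
  proof -
    have "open {u :: walsh. \<forall>l\<in>{..<N}. u l \<in> {x l}}"
      by (rule product_topology_basis') (simp_all add: discrete_topology_class.open_discrete)
    then show ?thesis by (simp add: Ball_def)
  qed
  have open_cyl: "open (cyl N z)" for N z
  proof -
    have "cyl N z = {u. \<forall>l<N. u l = fst z l} \<times> {u. \<forall>l<N. u l = snd z l}"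
      by (auto simp: cyl_def)
    then show ?thesis by (simp add: open_Times open1)
  qed
  \<comment> \<open>A basic open set of the product topology constrains finitely many coordinates,
    so it contains a cylinder around each of its points.\<close>
  have small1: "\<exists>N. {u. \<forall>l<N. u l = x l} \<subseteq> U" if U: "open U" "x \<in> U" for x :: walsh and U
  proof -
    have "openin (product_topology (\<lambda>i. euclidean) UNIV) U" using U by (simp add: open_fun_def)
    then obtain X where X: "x \<in> Pi\<^sub>E UNIV X" "finite {i. X i \<noteq> UNIV}" "Pi\<^sub>E UNIV X \<subseteq> U"
      using product_topology_open_contains_basis[of "\<lambda>i. euclidean" UNIV U x] U by auto
    obtain N where N: "\<And>i. X i \<noteq> UNIV \<Longrightarrow> i < N"
      using finite_nat_set_iff_bounded X(2) by auto
    have "{u. \<forall>l<N. u l = x l} \<subseteq> Pi\<^sub>E UNIV X"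
    proof
      fix u assume "u \<in> {u. \<forall>l<N. u l = x l}"
      then have "u l \<in> X l" for l using X(1) N[of l] by (cases "l < N") (auto simp: PiE_iff)
      then show "u \<in> Pi\<^sub>E UNIV X" by auto
    qed
    from subset_trans[OF this X(3)] show ?thesis by (rule exI)
  qed
  have "\<exists>N. \<forall>u\<in>cyl N z. \<bar>f u - f z\<bar> < \<epsilon> / 2" for z
  proof -
    have "open (f -` ball (f z) (\<epsilon> / 2))" by (rule open_vimage[OF open_ball f])
    moreover have "z \<in> f -` ball (f z) (\<epsilon> / 2)" using \<open>\<epsilon> > 0\<close> by simp
    ultimately obtain U V where UV: "open U" "open V" "fst z \<in> U" "snd z \<in> V" "U \<times> V \<subseteq> f -` ball (f z) (\<epsilon> / 2)"
      by (auto elim!: open_prod_elim)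
    obtain N M where NM: "{u. \<forall>l<N. u l = fst z l} \<subseteq> U" "{u. \<forall>l<M. u l = snd z l} \<subseteq> V"
      using small1 UV by meson
    have "cyl (max N M) z \<subseteq> U \<times> V"
      using NM by (auto simp: cyl_def subset_eq)
    then show ?thesis using UV(5) by (intro exI[of _ "max N M"]) (auto simp: dist_real_def abs_minus_commute subset_eq)
  qed
  then obtain \<nu> where \<nu>: "\<And>z u. u \<in> cyl (\<nu> z) z \<Longrightarrow> \<bar>f u - f z\<bar> < \<epsilon> / 2" by metis
  have cover: "UNIV \<subseteq> (\<Union>z\<in>UNIV. cyl (\<nu> z) z)" by (auto simp: cyl_def)
  obtain Z where "Z \<subseteq> UNIV" and Z: "finite Z" "UNIV \<subseteq> (\<Union>z\<in>Z. cyl (\<nu> z) z)"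
    by (rule compactE_image[OF compact_UNIV_walsh2 open_cyl cover])
  define N0 where "N0 = Max (insert 0 (\<nu> ` Z))"
  show ?thesis
  proof (intro exI[of _ N0] allI impI)
    fix N and z :: "walsh \<times> walsh" assume "N \<ge> N0"
    obtain x y where z: "z = (x, y)" by (cases z)
    obtain c where c: "c \<in> Z" "z \<in> cyl (\<nu> c) c" using Z by blast
    have "\<nu> c \<le> N" using \<open>N \<ge> N0\<close> Z(1) c(1) unfolding N0_def by (auto simp: Max_ge_iff)
    show "\<bar>f z - kaczmarz_sum (2 ^ N) (2 ^ N) f z\<bar> \<le> \<epsilon>"
      unfolding z
    proof (rule dyadic_partial_sum_near[OF f])
      fix s t :: walsh assume "\<And>l. l < N \<Longrightarrow> x l = s l" "\<And>l. l < N \<Longrightarrow> y l = t l"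
      then have "(s, t) \<in> cyl (\<nu> c) c" using c(2) \<open>\<nu> c \<le> N\<close> by (auto simp: cyl_def z)
      from \<nu>[OF this] \<nu>[OF c(2)] show "\<bar>f (s, t) - f (x, y)\<bar> \<le> \<epsilon>" unfolding z by linarith
    qed (use \<open>\<epsilon> > 0\<close> in simp)
  qed
qed

section \<open>Partial best approximations and oscillation over dyadic cells\<close>

lemma sup_norm_nonneg: "continuous_on UNIV g \<Longrightarrow> sup_norm g \<ge> 0"
  using le_sup_norm[of g undefined] by linarith

lemma
  assumes f: "continuous_on UNIV f" and \<alpha>: "\<forall>j<l. continuous_on UNIV (\<alpha> j)"
  shows continuous_on_approx1: "continuous_on UNIV (\<lambda>(x, y). f (x, y) - (\<Sum>j<l. \<alpha> j y * kaczmarz j x))"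
    and continuous_on_approx2: "continuous_on UNIV (\<lambda>(x, y). f (x, y) - (\<Sum>j<l. \<alpha> j x * kaczmarz j y))"
proof -
  have \<alpha>_fst: "continuous_on UNIV (\<lambda>z. \<alpha> j (fst z))" and \<alpha>_snd: "continuous_on UNIV (\<lambda>z. \<alpha> j (snd z))"
    if "j < l" for j
    using continuous_on_compose2[of UNIV "\<alpha> j" UNIV fst] continuous_on_compose2[of UNIV "\<alpha> j" UNIV snd] \<alpha> that
    by (simp_all add: continuous_on_fst continuous_on_snd continuous_on_id)
  show "continuous_on UNIV (\<lambda>(x, y). f (x, y) - (\<Sum>j<l. \<alpha> j y * kaczmarz j x))"
    unfolding case_prod_unfold prod.collapse
    by (intro continuous_on_diff f continuous_on_sum continuous_on_mult \<alpha>_snd continuous_on_kaczmarz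
        continuous_on_fst continuous_on_id) simp
  show "continuous_on UNIV (\<lambda>(x, y). f (x, y) - (\<Sum>j<l. \<alpha> j x * kaczmarz j y))"
    unfolding case_prod_unfold prod.collapse
    by (intro continuous_on_diff f continuous_on_sum continuous_on_mult \<alpha>_fst continuous_on_kaczmarz
        continuous_on_snd continuous_on_id) simp
qed

lemma ex_coefficients: "{\<alpha> :: nat \<Rightarrow> walsh \<Rightarrow> real. \<forall>j<l. continuous_on UNIV (\<alpha> j)} \<noteq> {}"
  by (auto intro!: exI[of _ "\<lambda>_ _. 0"])

lemma bdd_below_approx:
  assumes "continuous_on UNIV f"
  shows "bdd_below ((\<lambda>\<alpha>. sup_norm (\<lambda>(x, y). f (x, y) - (\<Sum>j<l. \<alpha> j y * kaczmarz j x))) `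
      {\<alpha>. \<forall>j<l. continuous_on UNIV (\<alpha> j)})"
    and "bdd_below ((\<lambda>\<beta>. sup_norm (\<lambda>(x, y). f (x, y) - (\<Sum>j<l. \<beta> j x * kaczmarz j y))) `
      {\<beta>. \<forall>j<l. continuous_on UNIV (\<beta> j)})"
  by (rule bdd_belowI2[where m = 0], rule sup_norm_nonneg, rule continuous_on_approx1, use assms in auto)
     (rule bdd_belowI2[where m = 0], rule sup_norm_nonneg, rule continuous_on_approx2, use assms in auto)

lemma best_approx_nonneg:
  assumes "continuous_on UNIV f"
  shows "best_approx1 l f \<ge> 0" "best_approx2 l f \<ge> 0"
  unfolding best_approx1_def best_approx2_def
  by (rule cINF_greatest[OF ex_coefficients], rule sup_norm_nonneg, rule continuous_on_approx1, use assms in auto)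
     (rule cINF_greatest[OF ex_coefficients], rule sup_norm_nonneg, rule continuous_on_approx2, use assms in auto)

text \<open>Padding the coefficients with zeros turns an approximant for \<open>k\<close> into one
  for \<open>l\<close> with the same error.\<close>

lemma best_approx_antimono:
  assumes f: "continuous_on UNIV f" and "k \<le> l"
  shows "best_approx1 l f \<le> best_approx1 k f" "best_approx2 l f \<le> best_approx2 k f"
proof -
  have extend: "(\<Sum>j<l. (if j < k then a j else 0) * c j) = (\<Sum>j<k. a j * c j)" for a c :: "nat \<Rightarrow> real"
    using \<open>k \<le> l\<close> by (intro sum.mono_neutral_cong_right) auto
  have cont: "\<forall>j<l. continuous_on UNIV (\<lambda>u. if j < k then \<alpha> j u else 0)"
    if "\<forall>j<k. continuous_on UNIV (\<alpha> j)" for \<alpha> :: "nat \<Rightarrow> walsh \<Rightarrow> real"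
  proof (intro allI impI)
    fix j
    show "continuous_on UNIV (\<lambda>u. if j < k then \<alpha> j u else 0)"
      using that by (cases "j < k") simp_all
  qed
  show "best_approx1 l f \<le> best_approx1 k f"
    unfolding best_approx1_def[of k]
  proof (rule cINF_greatest[OF ex_coefficients])
    fix \<alpha> :: "nat \<Rightarrow> walsh \<Rightarrow> real" assume "\<alpha> \<in> {\<alpha>. \<forall>j<k. continuous_on UNIV (\<alpha> j)}"
    with cont[of \<alpha>] have "(\<lambda>j u. if j < k then \<alpha> j u else 0) \<in> {\<alpha>. \<forall>j<l. continuous_on UNIV (\<alpha> j)}"
      by simp
    from cINF_lower[OF bdd_below_approx(1)[OF f] this]
    show "best_approx1 l f \<le> sup_norm (\<lambda>(x, y). f (x, y) - (\<Sum>j<k. \<alpha> j y * kaczmarz j x))"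
      unfolding best_approx1_def extend .
  qed
  show "best_approx2 l f \<le> best_approx2 k f"
    unfolding best_approx2_def[of k]
  proof (rule cINF_greatest[OF ex_coefficients])
    fix \<alpha> :: "nat \<Rightarrow> walsh \<Rightarrow> real" assume "\<alpha> \<in> {\<alpha>. \<forall>j<k. continuous_on UNIV (\<alpha> j)}"
    with cont[of \<alpha>] have "(\<lambda>j u. if j < k then \<alpha> j u else 0) \<in> {\<alpha>. \<forall>j<l. continuous_on UNIV (\<alpha> j)}"
      by simp
    from cINF_lower[OF bdd_below_approx(2)[OF f] this]
    show "best_approx2 l f \<le> sup_norm (\<lambda>(x, y). f (x, y) - (\<Sum>j<k. \<alpha> j x * kaczmarz j y))"
      unfolding best_approx2_def extend .
  qed
qed

text \<open>Kaczmarz functions of index below 2^N see only the first \<open>N\<close> coordinates,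
  so an approximant takes one common value at both points, and both values of \<open>f\<close> lie
  within its error of that number.\<close>

lemma oscillation_le_best_approx:
  assumes f: "continuous_on UNIV f" and agree: "\<And>l. l < N \<Longrightarrow> x l = s l"
  shows "\<bar>f (s, y) - f (x, y)\<bar> \<le> 2 * best_approx1 (2 ^ N) f"
    and "\<bar>f (y, s) - f (y, x)\<bar> \<le> 2 * best_approx2 (2 ^ N) f"
proof -
  have tri: "\<bar>a - b\<bar> / 2 \<le> e" if "\<bar>a - p\<bar> \<le> e" "\<bar>b - p\<bar> \<le> e" for a b p e :: real
  proof -
    have "\<bar>a - b\<bar> \<le> 2 * e" using that by linarith
    then show ?thesis by simp
  qed
  \<comment> \<open>Half the difference is a lower bound for the error of every competitor, hence
    for the infimum.\<close>
  have "\<bar>f (s, y) - f (x, y)\<bar> / 2 \<le> best_approx1 (2 ^ N) f"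
    unfolding best_approx1_def
  proof (rule cINF_greatest[OF ex_coefficients])
    fix \<alpha> :: "nat \<Rightarrow> walsh \<Rightarrow> real" assume "\<alpha> \<in> {\<alpha>. \<forall>j<2^N. continuous_on UNIV (\<alpha> j)}"
    then have le: "\<bar>f (u, y) - (\<Sum>j<2^N. \<alpha> j y * kaczmarz j u)\<bar> \<le>
        sup_norm (\<lambda>(x, y). f (x, y) - (\<Sum>j<2^N. \<alpha> j y * kaczmarz j x))" for u
      using le_sup_norm[OF continuous_on_approx1[OF f], of "2 ^ N" \<alpha> "(u, y)"] by simp
    have eq: "(\<Sum>j<2^N. \<alpha> j y * kaczmarz j x) = (\<Sum>j<2^N. \<alpha> j y * kaczmarz j s)"
      using kaczmarz_eqI[OF _ agree] by (intro sum.cong) auto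
    show "\<bar>f (s, y) - f (x, y)\<bar> / 2 \<le> sup_norm (\<lambda>(x, y). f (x, y) - (\<Sum>j<2^N. \<alpha> j y * kaczmarz j x))"
      by (rule tri[OF le[of s, folded eq] le[of x]])
  qed
  then show "\<bar>f (s, y) - f (x, y)\<bar> \<le> 2 * best_approx1 (2 ^ N) f" by simp
  have "\<bar>f (y, s) - f (y, x)\<bar> / 2 \<le> best_approx2 (2 ^ N) f"
    unfolding best_approx2_def
  proof (rule cINF_greatest[OF ex_coefficients])
    fix \<beta> :: "nat \<Rightarrow> walsh \<Rightarrow> real" assume "\<beta> \<in> {\<beta>. \<forall>j<2^N. continuous_on UNIV (\<beta> j)}"
    then have le: "\<bar>f (y, u) - (\<Sum>j<2^N. \<beta> j y * kaczmarz j u)\<bar> \<le>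
        sup_norm (\<lambda>(x, y). f (x, y) - (\<Sum>j<2^N. \<beta> j x * kaczmarz j y))" for u
      using le_sup_norm[OF continuous_on_approx2[OF f], of "2 ^ N" \<beta> "(y, u)"] by simp
    have eq: "(\<Sum>j<2^N. \<beta> j y * kaczmarz j x) = (\<Sum>j<2^N. \<beta> j y * kaczmarz j s)"
      using kaczmarz_eqI[OF _ agree] by (intro sum.cong) auto
    show "\<bar>f (y, s) - f (y, x)\<bar> / 2 \<le> sup_norm (\<lambda>(x, y). f (x, y) - (\<Sum>j<2^N. \<beta> j x * kaczmarz j y))"
      by (rule tri[OF le[of s, folded eq] le[of x]])
  qed
  then show "\<bar>f (y, s) - f (y, x)\<bar> \<le> 2 * best_approx2 (2 ^ N) f" by simp
qed

text \<open>Going from \<open>(x, y)\<close> to \<open>(s, t)\<close> through \<open>(x, t)\<close>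
  changes one variable at a time, each change being controlled by one partial best
  approximation.\<close>

lemma dyadic_partial_sum_error:
  assumes f: "continuous_on UNIV f"
  shows "\<bar>f z - kaczmarz_sum (2 ^ N) (2 ^ N) f z\<bar> \<le> 2 * best_approx1 (2 ^ N) f + 2 * best_approx2 (2 ^ N) f"
proof -
  obtain x y where z: "z = (x, y)" by (cases z)
  show ?thesis unfolding z
  proof (rule dyadic_partial_sum_near[OF f])
    fix s t :: walsh assume "\<And>l. l < N \<Longrightarrow> x l = s l" "\<And>l. l < N \<Longrightarrow> y l = t l"
    then have "\<bar>f (s, t) - f (x, t)\<bar> \<le> 2 * best_approx1 (2 ^ N) f" "\<bar>f (x, t) - f (x, y)\<bar> \<le> 2 * best_approx2 (2 ^ N) f"
      using oscillation_le_best_approx[OF f] by blast+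
    then show "\<bar>f (s, t) - f (x, y)\<bar> \<le> 2 * best_approx1 (2 ^ N) f + 2 * best_approx2 (2 ^ N) f"
      by linarith
  qed (use best_approx_nonneg[OF f] in simp)
qed

section \<open>Partial sums of the residual\<close>

lemma kaczmarz_sum_cmult: "kaczmarz_sum n m (\<lambda>z. c * g z) z = c * kaczmarz_sum n m g z"
  by (simp add: kaczmarz_sum_def kaczmarz_coeff_def case_prod_unfold mult.assoc sum_distrib_left)

lemma kaczmarz_coeff_kaczmarz_sum:
  "kaczmarz_coeff (kaczmarz_sum n m f) k i = of_bool (k < n \<and> i < m) * kaczmarz_coeff f k i"
proof -
  have int: "integrable walsh_measure2 (\<lambda>z. (kaczmarz a (fst z) * kaczmarz k (fst z)) * (kaczmarz b (snd z) * kaczmarz i (snd z)))" for a b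
    by (intro integrable_walsh2 continuous_intros)
  have val: "(\<integral>z. (kaczmarz a (fst z) * kaczmarz k (fst z)) * (kaczmarz b (snd z) * kaczmarz i (snd z)) \<partial>walsh_measure2)
      = of_bool (a = k) * of_bool (b = i)" for a b
    by (subst integral_walsh2_times) (auto intro!: continuous_intros simp: kaczmarz_orthonormal)
  have "kaczmarz_coeff (kaczmarz_sum n m f) k i = (\<integral>z. (\<Sum>a<n. \<Sum>b<m. kaczmarz_coeff f a b *
      ((kaczmarz a (fst z) * kaczmarz k (fst z)) * (kaczmarz b (snd z) * kaczmarz i (snd z)))) \<partial>walsh_measure2)"
    unfolding kaczmarz_coeff_def[of "kaczmarz_sum n m f"]
    by (simp add: kaczmarz_sum_def case_prod_unfold sum_distrib_left sum_distrib_right mult_ac)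
  also have "\<dots> = (\<Sum>a<n. \<Sum>b<m. kaczmarz_coeff f a b * (of_bool (a = k) * of_bool (b = i)))"
    using int by (simp add: val)
  also have "\<dots> = (\<Sum>a<n. \<Sum>b<m. if b = i then (if a = k then kaczmarz_coeff f a b else 0) else 0)"
    by (intro sum.cong refl) auto
  also have "\<dots> = of_bool (k < n \<and> i < m) * kaczmarz_coeff f k i"
    by (cases "i < m") (simp_all add: sum.delta)
  finally show ?thesis .
qed

text \<open>The partial sum of order \<open>n\<close> reproduces the one of order \<open>M\<close>.
  Hence \<open>f\<close> and its residual have the same deviation from their partial sums, and
  \<open>f\<close> can be replaced by a function of small norm.\<close>

lemma kaczmarz_sum_residual:
  assumes f: "continuous_on UNIV f" and "M \<le> n"
  shows "kaczmarz_sum n n (\<lambda>z. f z - kaczmarz_sum M M f z) z = kaczmarz_sum n n f z - kaczmarz_sum M M f z"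
proof -
  have int: "integrable walsh_measure2 (\<lambda>z. h z * kaczmarz k (fst z) * kaczmarz i (snd z))"
    if "continuous_on UNIV h" for h k i
    by (intro integrable_walsh2 continuous_intros that)
  have coeff: "kaczmarz_coeff (\<lambda>z. f z - kaczmarz_sum M M f z) k i =
      kaczmarz_coeff f k i - of_bool (k < M) * of_bool (i < M) * kaczmarz_coeff f k i" for k i
  proof -
    have "kaczmarz_coeff (\<lambda>z. f z - kaczmarz_sum M M f z) k i =
        kaczmarz_coeff f k i - kaczmarz_coeff (kaczmarz_sum M M f) k i"
      using int[OF f, of k i] int[of "kaczmarz_sum M M f" k i] continuous_on_kaczmarz_sum[OF continuous_on_id]
      by (simp add: kaczmarz_coeff_def case_prod_unfold left_diff_distrib)
    then show ?thesis by (simp add: kaczmarz_coeff_kaczmarz_sum)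
  qed
  obtain x y where z: "z = (x, y)" by (cases z)
  have "(\<Sum>k<n. \<Sum>i<n. of_bool (k < M) * of_bool (i < M) * kaczmarz_coeff f k i * kaczmarz k x * kaczmarz i y) =
      (\<Sum>k<M. \<Sum>i<n. of_bool (k < M) * of_bool (i < M) * kaczmarz_coeff f k i * kaczmarz k x * kaczmarz i y)"
    using \<open>M \<le> n\<close> by (intro sum.mono_neutral_right) auto
  also have "\<dots> = (\<Sum>k<M. \<Sum>i<M. kaczmarz_coeff f k i * kaczmarz k x * kaczmarz i y)"
    using \<open>M \<le> n\<close> by (intro sum.cong refl sum.mono_neutral_cong_right) auto
  finally show ?thesis
    unfolding z kaczmarz_sum_def[of n n] prod.case coeff
    by (simp add: kaczmarz_sum_def left_diff_distrib sum_subtractf)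
qed

section \<open>The strong summability estimate\<close>

text \<open>Convexity along the segment from 0 to \<open>u\<close>; it moves the small factor
  \<open>\<theta>\<close> out of the exponent.\<close>

lemma exp_scale_le:
  fixes u \<theta> :: real
  assumes "0 \<le> \<theta>" "\<theta> \<le> 1"
  shows "exp (\<theta> * u) - 1 \<le> \<theta> * (exp u - 1)"
  using convex_onD[OF exp_convex assms, of 0 u] by (simp add: algebra_simps)

text \<open>Dividing \<open>g\<close> by \<open>\<epsilon>\<close> reduces to the unit ball and puts
  \<open>A * sqrt \<epsilon>\<close>, a fraction \<open>\<theta>\<close> of 1/4, into the exponent.
  Convexity then makes \<open>\<theta>\<close> a linear factor.\<close>

lemma strong_exponential_bound_scaled:
  obtains C where "C > 0"
    "\<And>N g z A \<epsilon>. \<lbrakk>continuous_on UNIV g; \<And>z. \<bar>g z\<bar> \<le> \<epsilon>; \<epsilon> > 0; A \<ge> 0; 4 * A * sqrt \<epsilon> \<le> 1\<rbrakk> \<Longrightarrow>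
      (\<Sum>n\<in>{2 ^ N..<2 ^ Suc N}. exp (A * sqrt \<bar>kaczmarz_sum n n g z - g z\<bar>) - 1) \<le> C * A * 2 ^ N * sqrt \<epsilon>"
proof -
  obtain C where C: "C > 0"
    "\<And>N g z. \<lbrakk>continuous_on UNIV g; \<And>z. \<bar>g z\<bar> \<le> 1\<rbrakk> \<Longrightarrow>
      (\<Sum>n\<in>{2 ^ N..<2 ^ Suc N}. exp (1/4 * sqrt \<bar>kaczmarz_sum n n g z\<bar>)) \<le> C * 2 ^ N"
    using strong_exponential_bound by blast
  show ?thesis
  proof (rule that[of "4 * exp (1/4) * C"])
    show "4 * exp (1/4) * C > 0" using C(1) by simp
    fix N :: nat and g :: "walsh \<times> walsh \<Rightarrow> real" and z :: "walsh \<times> walsh" and A \<epsilon> :: real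
    assume g: "continuous_on UNIV g" "\<And>z. \<bar>g z\<bar> \<le> \<epsilon>" and "\<epsilon> > 0" "A \<ge> 0" and small: "4 * A * sqrt \<epsilon> \<le> 1"
    define h where "h z = 1 / \<epsilon> * g z" for z
    define \<theta> where "\<theta> = 4 * A * sqrt \<epsilon>"
    have \<theta>: "0 \<le> \<theta>" "\<theta> \<le> 1" using small \<open>A \<ge> 0\<close> \<open>\<epsilon> > 0\<close> by (simp_all add: \<theta>_def)
    have h: "continuous_on UNIV h" "\<And>z. \<bar>h z\<bar> \<le> 1"
      unfolding h_def by (intro continuous_on_mult continuous_on_const g(1))
        (use g(2) \<open>\<epsilon> > 0\<close> in \<open>simp add: abs_mult divide_le_eq\<close>)
    have "(\<Sum>n\<in>{2 ^ N..<2 ^ Suc N}. exp (A * sqrt \<bar>kaczmarz_sum n n g z - g z\<bar>) - 1) \<le>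
        (\<Sum>n\<in>{2 ^ N..<2 ^ Suc N}. \<theta> * exp (1/4) * exp (1/4 * sqrt \<bar>kaczmarz_sum n n h z\<bar>))"
    proof (rule sum_mono)
      fix n
      have "kaczmarz_sum n n g z - g z = \<epsilon> * (kaczmarz_sum n n h z - h z)"
        using \<open>\<epsilon> > 0\<close> unfolding h_def[abs_def] kaczmarz_sum_cmult by (simp add: field_simps)
      then have "sqrt \<bar>kaczmarz_sum n n g z - g z\<bar> = sqrt \<epsilon> * sqrt \<bar>kaczmarz_sum n n h z - h z\<bar>"
        using \<open>\<epsilon> > 0\<close> by (simp add: abs_mult real_sqrt_mult)
      \<comment> \<open>Subtracting \<open>h\<close>, which is at most 1 in modulus, costs only the
        constant factor \<open>exp (1/4)\<close>.\<close>
      also have "sqrt \<bar>kaczmarz_sum n n h z - h z\<bar> \<le> sqrt (\<bar>kaczmarz_sum n n h z\<bar> + 1)"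
        using h(2)[of z] by simp
      also have "\<dots> \<le> sqrt \<bar>kaczmarz_sum n n h z\<bar> + 1"
        using sqrt_add_le_add_sqrt[of "\<bar>kaczmarz_sum n n h z\<bar>" 1] by simp
      finally have "A * sqrt \<bar>kaczmarz_sum n n g z - g z\<bar> \<le> A * (sqrt \<epsilon> * (sqrt \<bar>kaczmarz_sum n n h z\<bar> + 1))"
        using \<open>A \<ge> 0\<close> \<open>\<epsilon> > 0\<close> by (simp add: mult_left_mono)
      also have "\<dots> = \<theta> * (1/4 + 1/4 * sqrt \<bar>kaczmarz_sum n n h z\<bar>)"
        by (simp add: \<theta>_def algebra_simps)
      finally have "exp (A * sqrt \<bar>kaczmarz_sum n n g z - g z\<bar>) - 1 \<le>
          exp (\<theta> * (1/4 + 1/4 * sqrt \<bar>kaczmarz_sum n n h z\<bar>)) - 1"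
        by simp
      also have "\<dots> \<le> \<theta> * (exp (1/4 + 1/4 * sqrt \<bar>kaczmarz_sum n n h z\<bar>) - 1)"
        by (rule exp_scale_le[OF \<theta>])
      also have "\<dots> \<le> \<theta> * exp (1/4 + 1/4 * sqrt \<bar>kaczmarz_sum n n h z\<bar>)"
        using \<theta>(1) by (intro mult_left_mono) auto
      finally show "exp (A * sqrt \<bar>kaczmarz_sum n n g z - g z\<bar>) - 1 \<le>
          \<theta> * exp (1/4) * exp (1/4 * sqrt \<bar>kaczmarz_sum n n h z\<bar>)"
        by (simp add: exp_add mult.assoc)
    qed
    also have "\<dots> \<le> \<theta> * exp (1/4) * (C * 2 ^ N)"
      unfolding sum_distrib_left[symmetric] using \<theta>(1) by (intro mult_left_mono C(2) h) auto
    also have "\<dots> = 4 * exp (1/4) * C * A * 2 ^ N * sqrt \<epsilon>" by (simp add: \<theta>_def)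
    finally show "(\<Sum>n\<in>{2 ^ N..<2 ^ Suc N}. exp (A * sqrt \<bar>kaczmarz_sum n n g z - g z\<bar>) - 1) \<le>
      4 * exp (1/4) * C * A * 2 ^ N * sqrt \<epsilon>" .
  qed
qed

text \<open>On block \<open>N\<close> the function \<open>f\<close> is replaced by its residual of
  order 2^N. For all but finitely many \<open>N\<close> this is small enough for the scaled bound;
  the remaining blocks are absorbed into the constant.\<close>

lemma dyadic_block_bound:
  assumes f: "continuous_on UNIV f" and "A > 0"
  obtains c where "c > 0"
    "\<And>N z. (\<Sum>n\<in>{2 ^ N..<2 ^ Suc N}. exp (A * sqrt \<bar>kaczmarz_sum n n f z - f z\<bar>) - 1) \<le>
      c * 2 ^ N * sqrt (2 * best_approx1 (2 ^ N) f + 2 * best_approx2 (2 ^ N) f)"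
proof -
  define g where "g N z = f z - kaczmarz_sum (2 ^ N) (2 ^ N) f z" for N z
  define \<delta> where "\<delta> N = sup_norm (g N)" for N
  define F where "F N z = (\<Sum>n\<in>{2 ^ N..<2 ^ Suc N}. exp (A * sqrt \<bar>kaczmarz_sum n n f z - f z\<bar>) - 1)" for N z
  have g: "continuous_on UNIV (g N)" for N
    unfolding g_def[abs_def] by (intro continuous_on_diff f continuous_on_kaczmarz_sum continuous_on_id)
  have \<delta>: "\<bar>g N z\<bar> \<le> \<delta> N" for N z unfolding \<delta>_def by (rule le_sup_norm[OF g])
  have \<delta>_nonneg: "\<delta> N \<ge> 0" for N unfolding \<delta>_def by (rule sup_norm_nonneg[OF g])
  have F_eq: "F N z = (\<Sum>n\<in>{2 ^ N..<2 ^ Suc N}. exp (A * sqrt \<bar>kaczmarz_sum n n (g N) z - g N z\<bar>) - 1)" for N z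
    unfolding F_def
  proof (rule sum.cong[OF refl])
    fix n :: nat assume "n \<in> {2 ^ N..<2 ^ Suc N}"
    then have "kaczmarz_sum n n (g N) z - g N z = kaczmarz_sum n n f z - f z"
      using kaczmarz_sum_residual[OF f, of "2 ^ N" n z] by (simp add: g_def[abs_def])
    then show "exp (A * sqrt \<bar>kaczmarz_sum n n f z - f z\<bar>) - 1 =
        exp (A * sqrt \<bar>kaczmarz_sum n n (g N) z - g N z\<bar>) - 1" by simp
  qed
  obtain C where C: "C > 0"
    "\<And>N g z A \<epsilon>. \<lbrakk>continuous_on UNIV g; \<And>z. \<bar>g z\<bar> \<le> \<epsilon>; \<epsilon> > 0; A \<ge> 0; 4 * A * sqrt \<epsilon> \<le> 1\<rbrakk> \<Longrightarrow>
      (\<Sum>n\<in>{2 ^ N..<2 ^ Suc N}. exp (A * sqrt \<bar>kaczmarz_sum n n g z - g z\<bar>) - 1) \<le> C * A * 2 ^ N * sqrt \<epsilon>"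
    using strong_exponential_bound_scaled by blast
  have small: "F N z \<le> C * A * (2 ^ N * sqrt (\<delta> N))" if "4 * A * sqrt (\<delta> N) \<le> 1" for N z
  \<comment> \<open>The scaled bound requires a positive norm, so a vanishing residual is treated
    directly.\<close>
  proof (cases "\<delta> N = 0")
    case True
    then have "g N = (\<lambda>z. 0 * f z)" using \<delta>[of N] by (simp add: fun_eq_iff)
    then have "kaczmarz_sum n n (g N) z - g N z = 0" for n
      using kaczmarz_sum_cmult[of n n 0 f z] by simp
    then show ?thesis using True by (simp add: F_eq)
  next
    case False
    then have "\<delta> N > 0" using \<delta>_nonneg[of N] by simp
    then have "F N z \<le> C * A * 2 ^ N * sqrt (\<delta> N)"
      unfolding F_eq using that \<open>A > 0\<close> by (intro C(2) g \<delta>) auto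
    then show ?thesis by (simp add: mult.assoc)
  qed
  have "\<exists>c\<ge>0. \<forall>z. F N z \<le> c * (2 ^ N * sqrt (\<delta> N))" for N
  proof (cases "4 * A * sqrt (\<delta> N) \<le> 1")
    case True
    then show ?thesis using small[OF True] C(1) \<open>A > 0\<close> by (intro exI[of _ "C * A"]) auto
  next
    case False
    \<comment> \<open>Here the exponent cannot be reduced to 1/4. Compactness bounds
      \<open>F N\<close> by some \<open>K\<close>, and \<open>4 * A * sqrt (\<delta> N) > 1\<close>
      turns \<open>K\<close> into a multiple of \<open>sqrt (\<delta> N)\<close>.\<close>
    have "continuous_on UNIV (F N)"
      unfolding F_def[abs_def]
      by (intro continuous_on_sum continuous_on_diff continuous_on_exp continuous_on_mult continuous_on_const
          continuous_on_real_sqrt continuous_on_rabs f continuous_on_kaczmarz_sum continuous_on_id)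
    then obtain K where K: "\<And>z. \<bar>F N z\<bar> \<le> K" using continuous_bounded by blast
    then have "K \<ge> 0" by (meson abs_ge_zero order_trans)
    have "F N z \<le> (K * (4 * A)) * (2 ^ N * sqrt (\<delta> N))" for z
    proof -
      have "F N z \<le> K * 1" using K[of z] by simp
      also have "\<dots> \<le> K * ((4 * A * sqrt (\<delta> N)) * 2 ^ N)"
      proof (intro mult_left_mono \<open>K \<ge> 0\<close>)
        have "1 * 1 \<le> (4 * A * sqrt (\<delta> N)) * 2 ^ N" using False by (intro mult_mono) auto
        then show "1 \<le> (4 * A * sqrt (\<delta> N)) * 2 ^ N" by simp
      qed
      finally show ?thesis by (simp add: mult_ac)
    qed
    then show ?thesis using \<open>K \<ge> 0\<close> \<open>A > 0\<close> by (intro exI[of _ "K * (4 * A)"]) auto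
  qed
  then obtain b where b: "\<And>N. b N \<ge> 0" "\<And>N z. F N z \<le> b N * (2 ^ N * sqrt (\<delta> N))" by metis
  \<comment> \<open>A norm of at most \<open>(1 / (4 * A))\<^sup>2\<close> is exactly what makes
    \<open>4 * A * sqrt (\<delta> N)\<close> at most 1.\<close>
  obtain N0 where N0: "\<And>N z. N \<ge> N0 \<Longrightarrow> \<bar>g N z\<bar> \<le> (1 / (4 * A))\<^sup>2"
    using dyadic_partial_sums_converge[OF f, of "(1 / (4 * A))\<^sup>2"] \<open>A > 0\<close> by (auto simp: g_def)
  define c where "c = C * A + (\<Sum>N<N0. b N)"
  have "F N z \<le> c * (2 ^ N * sqrt (\<delta> N))" for N z
  proof (cases "N < N0")
    case True
    then have "b N \<le> c"
      using member_le_sum[of N "{..<N0}" b] b(1) C(1) \<open>A > 0\<close> unfolding c_def by (simp add: add_increasing)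
    then show ?thesis
      using b(2)[of N z] \<delta>_nonneg[of N] by (meson mult_right_mono order_trans real_sqrt_ge_zero zero_le_mult_iff zero_le_numeral zero_le_power)
  next
    case False
    then have "\<delta> N \<le> (1 / (4 * A))\<^sup>2" unfolding \<delta>_def using N0 by (intro sup_norm_le) simp
    then have "sqrt (\<delta> N) \<le> 1 / (4 * A)" using \<open>A > 0\<close> by (intro real_le_lsqrt) (auto simp: \<delta>_nonneg)
    then have "4 * A * sqrt (\<delta> N) \<le> 1" using \<open>A > 0\<close> by (simp add: field_simps)
    then have "F N z \<le> C * A * (2 ^ N * sqrt (\<delta> N))" by (rule small)
    also have "\<dots> \<le> c * (2 ^ N * sqrt (\<delta> N))"
      using b(1) \<delta>_nonneg[of N] by (intro mult_right_mono) (auto simp: c_def sum_nonneg)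
    finally show ?thesis .
  qed
  moreover have "\<delta> N \<le> 2 * best_approx1 (2 ^ N) f + 2 * best_approx2 (2 ^ N) f" for N
    unfolding \<delta>_def g_def[abs_def] by (intro sup_norm_le dyadic_partial_sum_error f)
  moreover have "c > 0" unfolding c_def using C(1) \<open>A > 0\<close> b(1) by (intro add_pos_nonneg sum_nonneg) auto
  ultimately have "F N z \<le> c * (2 ^ N * sqrt (2 * best_approx1 (2 ^ N) f + 2 * best_approx2 (2 ^ N) f))" for N z
    by (smt (verit) mult_left_mono real_sqrt_le_mono zero_le_power)
  then show ?thesis using that[OF \<open>c > 0\<close>] by (simp add: F_def mult.assoc)
qed

text \<open>Cauchy condensation: the 2^N values between 2^N, excluded, and 2^(N+1) are all at least
  the last one, so twice their sum dominates the dyadic term.\<close>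

lemma sum_dyadic_values_le:
  fixes e :: "nat \<Rightarrow> real"
  assumes "\<And>l. e l \<ge> 0" "\<And>k l. k \<le> l \<Longrightarrow> e l \<le> e k"
  shows "(\<Sum>M\<le>N. 2 ^ M * e (2 ^ M)) \<le> 2 * (\<Sum>l=1..2 ^ N. e l)"
proof (induction N)
  case 0
  then show ?case using assms(1) by simp
next
  case (Suc N)
  have "(\<Sum>l\<in>{(2::nat) ^ N<..2 ^ Suc N}. e (2 ^ Suc N)) \<le> (\<Sum>l\<in>{2 ^ N<..2 ^ Suc N}. e l)"
    by (intro sum_mono assms(2)) auto
  then have "2 ^ Suc N * e (2 ^ Suc N) \<le> 2 * (\<Sum>l\<in>{2 ^ N<..2 ^ Suc N}. e l)" by simp
  moreover have "(\<Sum>l=1..2 ^ Suc N. e l) = (\<Sum>l=1..2 ^ N. e l) + (\<Sum>l\<in>{2 ^ N<..2 ^ Suc N}. e l)"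
    by (subst sum.union_disjoint[symmetric]) (auto intro!: sum.cong)
  ultimately show ?case using Suc by simp
qed

lemma sum_dyadic_blocks:
  fixes h :: "nat \<Rightarrow> real"
  shows "(\<Sum>l\<in>{1..<2 ^ Suc N}. h l) = (\<Sum>M\<le>N. \<Sum>l\<in>{2 ^ M..<2 ^ Suc M}. h l)"
proof (induction N)
  case (Suc N)
  have "(\<Sum>l\<in>{1..<2 ^ Suc (Suc N)}. h l) = (\<Sum>l\<in>{1..<2 ^ Suc N}. h l) + (\<Sum>l\<in>{2 ^ Suc N..<2 ^ Suc (Suc N)}. h l)"
    by (rule sum.atLeastLessThan_concat[symmetric]) auto
  then show ?case by (simp only: Suc sum.atMost_Suc)
qed simp

theorem theorem1:
  fixes f :: "walsh \<times> walsh \<Rightarrow> real"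
  assumes "continuous_on UNIV f"
  shows "\<forall>A::real. A > 0 \<longrightarrow>
    (\<exists>c::real. c > 0 \<and>
      (\<forall>n::nat. n \<ge> 1 \<longrightarrow>
        sup_norm (\<lambda>z. 1 / real n *
          (\<Sum>l = 1..n. (exp (A * sqrt \<bar>kaczmarz_sum l l f z - f z\<bar>) - 1)))
        \<le> c / real n * (\<Sum>l = 1..n. (sqrt (best_approx1 l f) + sqrt (best_approx2 l f)))))"
proof (intro allI impI)
  fix A :: real assume "A > 0"
  obtain c where c: "c > 0"
    "\<And>N z. (\<Sum>n\<in>{2 ^ N..<2 ^ Suc N}. exp (A * sqrt \<bar>kaczmarz_sum n n f z - f z\<bar>) - 1) \<le>
      c * 2 ^ N * sqrt (2 * best_approx1 (2 ^ N) f + 2 * best_approx2 (2 ^ N) f)"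
    using dyadic_block_bound[OF assms \<open>A > 0\<close>] by blast
  define e where "e l = sqrt (best_approx1 l f) + sqrt (best_approx2 l f)" for l
  note nonneg = best_approx_nonneg[OF assms]
  have e: "e l \<ge> 0" "k \<le> l \<Longrightarrow> e l \<le> e k" for k l
    using nonneg best_approx_antimono[OF assms] unfolding e_def by (auto intro!: add_mono)
  have sqrt_le: "sqrt (2 * best_approx1 l f + 2 * best_approx2 l f) \<le> 2 * e l" for l
  proof -
    have "sqrt (2 * best_approx1 l f + 2 * best_approx2 l f) \<le> sqrt (4 * best_approx1 l f) + sqrt (4 * best_approx2 l f)"
      by (rule order_trans[OF _ sqrt_add_le_add_sqrt]) (use nonneg[of l] in auto)
    then show ?thesis by (simp add: e_def real_sqrt_mult)
  qed
  define F where "F l z = exp (A * sqrt \<bar>kaczmarz_sum l l f z - f z\<bar>) - 1" for l z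
  have F: "F l z \<ge> 0" for l z using \<open>A > 0\<close> by (simp add: F_def)
  have main: "(\<Sum>l=1..n. F l z) \<le> 4 * c * (\<Sum>l=1..n. e l)" if n: "n \<ge> 1" for n z
  proof -
    obtain N where N: "2 ^ N \<le> n" "n < 2 ^ Suc N" using ex_dyadic_top[OF n] by blast
    \<comment> \<open>The summands are nonnegative, so the last dyadic block may be
      completed.\<close>
    have "(\<Sum>l=1..n. F l z) \<le> (\<Sum>l\<in>{1..<2 ^ Suc N}. F l z)"
      using N F by (intro sum_mono2) auto
    also have "\<dots> = (\<Sum>M\<le>N. \<Sum>l\<in>{2 ^ M..<2 ^ Suc M}. F l z)" by (rule sum_dyadic_blocks)
    also have "\<dots> \<le> (\<Sum>M\<le>N. c * 2 ^ M * (2 * e (2 ^ M)))"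
    proof (rule sum_mono)
      fix M
      have "(\<Sum>l\<in>{2 ^ M..<2 ^ Suc M}. F l z) \<le> c * 2 ^ M * sqrt (2 * best_approx1 (2 ^ M) f + 2 * best_approx2 (2 ^ M) f)"
        unfolding F_def by (rule c(2))
      also have "\<dots> \<le> c * 2 ^ M * (2 * e (2 ^ M))"
        using c(1) by (intro mult_left_mono sqrt_le) auto
      finally show "(\<Sum>l\<in>{2 ^ M..<2 ^ Suc M}. F l z) \<le> c * 2 ^ M * (2 * e (2 ^ M))" .
    qed
    also have "\<dots> = 2 * c * (\<Sum>M\<le>N. 2 ^ M * e (2 ^ M))"
      unfolding sum_distrib_left by (simp add: mult_ac)
    also have "\<dots> \<le> 2 * c * (2 * (\<Sum>l=1..2 ^ N. e l))"
      using c(1) by (intro mult_left_mono sum_dyadic_values_le e) auto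
    also have "\<dots> \<le> 2 * c * (2 * (\<Sum>l=1..n. e l))"
      using c(1) N(1) e(1) by (intro mult_left_mono sum_mono2) auto
    finally show ?thesis by simp
  qed
  show "\<exists>c>0. \<forall>n\<ge>1. sup_norm (\<lambda>z. 1 / real n * (\<Sum>l = 1..n. exp (A * sqrt \<bar>kaczmarz_sum l l f z - f z\<bar>) - 1))
      \<le> c / real n * (\<Sum>l = 1..n. sqrt (best_approx1 l f) + sqrt (best_approx2 l f))"
  \<comment> \<open>The 4 collects one factor 2 from \<open>sqrt_le\<close> and one from
    \<open>sum_dyadic_values_le\<close>.\<close>
  proof (intro exI[of _ "4 * c"] conjI allI impI)
    fix n :: nat assume n: "n \<ge> 1"
    have "sup_norm (\<lambda>z. 1 / real n * (\<Sum>l = 1..n. F l z)) \<le> 4 * c / real n * (\<Sum>l = 1..n. e l)"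
    proof (rule sup_norm_le)
      fix z
      have "\<bar>1 / real n * (\<Sum>l = 1..n. F l z)\<bar> = 1 / real n * (\<Sum>l = 1..n. F l z)"
        using F by (simp add: sum_nonneg)
      also have "\<dots> \<le> 1 / real n * (4 * c * (\<Sum>l = 1..n. e l))"
        by (intro mult_left_mono main n) simp
      finally show "\<bar>1 / real n * (\<Sum>l = 1..n. F l z)\<bar> \<le> 4 * c / real n * (\<Sum>l = 1..n. e l)" by simp
    qed
    then show "sup_norm (\<lambda>z. 1 / real n * (\<Sum>l = 1..n. exp (A * sqrt \<bar>kaczmarz_sum l l f z - f z\<bar>) - 1))
      \<le> 4 * c / real n * (\<Sum>l = 1..n. sqrt (best_approx1 l f) + sqrt (best_approx2 l f))"
      by (simp only: F_def e_def)
  qed (use c(1) in simp)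
qed

end
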